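(* Let $G$ be an infinite, quasi-transitive, connected, cubic (simple) graph, and define the sequence of graphs $(G_k : k=0,1,2,\dots)$ by $G_0=G$ and $G_{k+1}=F(G_k)$, where $F$ denotes the Fisher transformation applied at every vertex. Let $\mu_k$ be the connective constant of $G_k$ and let $\phi=\tfrac12(\sqrt5+1)$ be the golden mean. Then: (a) $\mu_k^{-1}=g(\mu_{k+1}^{-1})$ for all $k\ge 0$, where $g(x)=x^2+x^3$; (b) the sequence $(\mu_k)$ converges monotonely to $\phi$, and $$-\left(\tfrac47\right)^k\le \mu_k^{-1}-\phi^{-1}\le \left[\tfrac12(7-\sqrt5)\right]^k,\qquad k\ge 1.$$
   Context: All graphs are infinite, connected and simple (no loops, no multiple edges). A graph is cubic if every vertex has degree 3. A graph $G=(V,E)$ is quasi-transitive if there is a finite set $W\subseteq V$ such that every vertex of $V$ is mapped into $W$ by some automorphism of $G$. An $n$-step self-avoiding walk (SAW) is a walk with $n$ edges visiting no vertex more than once; if $\sigma_n(v)$ denotes the number of $n$-step SAWs starting at $v$, the connective constant of a quasi-transitive graph is $\mu(G)=\lim_{n\to\infty}\sigma_n(v)^{1/n}$, which exists and does not depend on $v$ (Hammersley). The Fisher transformation at a vertex $v$ of degree 3 with incident edges $\langle v,u_1\rangle,\langle v,u_2\rangle,\langle v,u_3\rangle$ replaces $v$ by three new vertices $v_1,v_2,v_3$ that are pairwise joined by edges (forming a triangle), and replaces each edge $\langle v,u_i\rangle$ by $\langle v_i,u_i\rangle$. For a cubic graph $G$, $F(G)$ is the cubic graph obtained by applying the Fisher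 transformation at every vertex of $G$ (so each edge $\langle u,v\rangle$ of $G$ becomes an edge joining a vertex of the triangle replacing $u$ to a vertex of the triangle replacing $v$). *)

theory Defs
  imports Complex_Main
begin

text \<open>An undirected graph is a set of vertices with a set of two-element sets of vertices.\<close>

type_synonym 'a ugraph = "'a set \<times> 'a set set"

abbreviation verts :: "'a ugraph \<Rightarrow> 'a set" where "verts G \<equiv> fst G"
abbreviation edges :: "'a ugraph \<Rightarrow> 'a set set" where "edges G \<equiv> snd G"

definition simple_graph :: "'a ugraph \<Rightarrow> bool" where
  "simple_graph G \<longleftrightarrow>
     (\<forall>e\<in>edges G. \<exists>u\<in>verts G. \<exists>v\<in>verts G. u \<noteq> v \<and> e = {u, v})"

definition infinite_graph :: "'a ugraph \<Rightarrow> bool" where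
  "infinite_graph G \<longleftrightarrow> infinite (verts G)"

definition vdegree :: "'a ugraph \<Rightarrow> 'a \<Rightarrow> nat" where
  "vdegree G v = card {e \<in> edges G. v \<in> e}"

definition cubic_graph :: "'a ugraph \<Rightarrow> bool" where
  "cubic_graph G \<longleftrightarrow> (\<forall>v\<in>verts G. vdegree G v = 3)"

text \<open>A walk with \<open>n\<close> edges is given by the list of its \<open>n + 1\<close> successive vertices.\<close>

definition is_walk :: "'a ugraph \<Rightarrow> 'a list \<Rightarrow> bool" where
  "is_walk G xs \<longleftrightarrow> xs \<noteq> [] \<and> set xs \<subseteq> verts G \<and>
     (\<forall>i. Suc i < length xs \<longrightarrow> {xs ! i, xs ! Suc i} \<in> edges G)"

definition connected_graph :: "'a ugraph \<Rightarrow> bool" where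
  "connected_graph G \<longleftrightarrow>
     (\<forall>u\<in>verts G. \<forall>v\<in>verts G. \<exists>xs. is_walk G xs \<and> hd xs = u \<and> last xs = v)"

definition graph_iso :: "('a \<Rightarrow> 'b) \<Rightarrow> 'a ugraph \<Rightarrow> 'b ugraph \<Rightarrow> bool" where
  "graph_iso f G H \<longleftrightarrow> bij_betw f (verts G) (verts H) \<and>
     (\<forall>u\<in>verts G. \<forall>v\<in>verts G. {u, v} \<in> edges G \<longleftrightarrow> {f u, f v} \<in> edges H)"

definition automorphism :: "('a \<Rightarrow> 'a) \<Rightarrow> 'a ugraph \<Rightarrow> bool" where
  "automorphism f G \<longleftrightarrow> graph_iso f G G"

definition quasi_transitive :: "'a ugraph \<Rightarrow> bool" where
  "quasi_transitive G \<longleftrightarrow>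
     (\<exists>W. W \<subseteq> verts G \<and> finite W \<and> (\<forall>v\<in>verts G. \<exists>f. automorphism f G \<and> f v \<in> W))"

definition saws :: "'a ugraph \<Rightarrow> 'a \<Rightarrow> nat \<Rightarrow> 'a list set" where
  "saws G v n = {xs. is_walk G xs \<and> distinct xs \<and> hd xs = v \<and> length xs = n + 1}"

definition saw_count :: "'a ugraph \<Rightarrow> 'a \<Rightarrow> nat \<Rightarrow> nat" where
  "saw_count G v n = card (saws G v n)"

text \<open>The common value of the limits \<open>\<sigma>\<^sub>n(v)\<^bsup>1/n\<^esup>\<close> over all vertices \<open>v\<close>; it exists for
  infinite connected quasi-transitive graphs of finite degree, by Hammersley's theorem.\<close>

definition connective_constant :: "'a ugraph \<Rightarrow> real" where
  "connective_constant G =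
     (THE \<mu>. \<forall>v\<in>verts G. (\<lambda>n. root n (real (saw_count G v n))) \<longlonglongrightarrow> \<mu>)"

text \<open>The vertex \<open>Corner v u\<close> is the vertex of the triangle replacing \<open>v\<close> that takes over the
  edge \<open>{v, u}\<close>. Since corners are again of type \<open>'a fvert\<close>, the Fisher transformation can be
  iterated within one type.\<close>

datatype 'a fvert = Orig 'a | Corner "'a fvert" "'a fvert"

definition fisher :: "'a fvert ugraph \<Rightarrow> 'a fvert ugraph" where
  "fisher G =
     ({Corner v u | v u. {v, u} \<in> edges G},
      {{Corner v u, Corner v w} | v u w. {v, u} \<in> edges G \<and> {v, w} \<in> edges G \<and> u \<noteq> w} \<union>
      {{Corner v u, Corner u v} | v u. {v, u} \<in> edges G})"

definition relabel :: "('a \<Rightarrow> 'b) \<Rightarrow> 'a ugraph \<Rightarrow> 'b ugraph" where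
  "relabel f G = (f ` verts G, (\<lambda>e. f ` e) ` edges G)"

text \<open>The sequence starts from the copy of \<open>G\<close> in which every vertex \<open>v\<close> is renamed to
  \<open>Orig v\<close>.\<close>

primrec fisher_seq :: "'a ugraph \<Rightarrow> nat \<Rightarrow> 'a fvert ugraph" where
  "fisher_seq G 0 = relabel Orig G"
| "fisher_seq G (Suc k) = fisher (fisher_seq G k)"

definition golden_mean :: real where
  "golden_mean = (sqrt 5 + 1) / 2"

lemma graph_iso_relabel:
  assumes "inj f"
  shows "graph_iso f G (relabel f G)"
proof -
  have "{f u, f v} \<in> (\<lambda>e. f ` e) ` edges G \<longleftrightarrow> {u, v} \<in> edges G" for u v
  proof -
    have "{f u, f v} = f ` {u, v}" by simp
    then show ?thesis
      using inj_image_eq_iff[OF assms] by (metis (no_types, lifting) image_iff)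
  qed
  then show ?thesis
    using assms by (auto simp: graph_iso_def relabel_def bij_betw_def intro: inj_on_subset)
qed

lemma saw_count_relabel:
  assumes "inj f"
  shows "saw_count (relabel f G) (f v) n = saw_count G v n"
proof -
  have edge: "{f a, f b} \<in> edges (relabel f G) \<longleftrightarrow> {a, b} \<in> edges G" for a b
  proof -
    have "{f a, f b} = f ` {a, b}" by simp
    then show ?thesis
      using inj_image_eq_iff[OF assms]
      by (metis (no_types, lifting) image_iff relabel_def snd_conv)
  qed
  have walk: "is_walk (relabel f G) (map f xs) \<longleftrightarrow> is_walk G xs" for xs
    using assms edge
    by (auto simp: is_walk_def relabel_def inj_image_subset_iff inj_image_mem_iff)
  have mem: "map f xs \<in> saws (relabel f G) (f v) n \<longleftrightarrow> xs \<in> saws G v n" for xs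
  proof -
    have "hd (map f xs) = f v \<longleftrightarrow> hd xs = v" if "xs \<noteq> []"
      by (simp only: hd_map[OF that] inj_eq[OF assms])
    moreover have "distinct (map f xs) \<longleftrightarrow> distinct xs"
      using inj_on_subset[OF assms] by (simp add: distinct_map)
    ultimately show ?thesis
      unfolding saws_def mem_Collect_eq walk length_map by (metis is_walk_def)
  qed
  have "saws (relabel f G) (f v) n = map f ` saws G v n"
  proof (intro equalityI subsetI)
    fix ys assume ys: "ys \<in> saws (relabel f G) (f v) n"
    then have "set ys \<subseteq> range f"
      by (auto simp: saws_def is_walk_def relabel_def)
    then obtain xs where "ys = map f xs"
      by (metis ex_map_conv subsetD rangeE)
    then show "ys \<in> map f ` saws G v n" using ys mem by blast
  qed (use mem in auto)
  moreover have "inj_on (map f) (saws G v n)"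
    using assms by (simp add: inj_on_def inj_map_eq_map)
  ultimately show ?thesis
    by (simp add: saw_count_def card_image)
qed

lemma connective_constant_fisher_seq_0:
  fixes G :: "'a ugraph"
  shows "connective_constant (fisher_seq G 0) = connective_constant G"
proof -
  have verts: "verts (relabel Orig G) = Orig ` verts G" by (simp add: relabel_def)
  have "inj (Orig :: 'a \<Rightarrow> 'a fvert)" by (simp add: inj_def)
  then have "(\<forall>v\<in>verts (relabel Orig G). (\<lambda>n. root n (real (saw_count (relabel Orig G) v n))) \<longlonglongrightarrow> \<mu>)
      \<longleftrightarrow> (\<forall>v\<in>verts G. (\<lambda>n. root n (real (saw_count G v n))) \<longlonglongrightarrow> \<mu>)" for \<mu>
    by (simp only: verts ball_simps saw_count_relabel)
  then show ?thesis
    by (simp only: connective_constant_def fisher_seq.simps)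
qed

end

theory Submission
  imports Defs
begin

text \<open>
  Count the self-avoiding walks from a vertex that avoid a forbidden set; these numbers satisfy a
  recursion on the first step, and all estimates are inductions along it.

  Existence of the connective constant: the maximal count is submultiplicative, which gives a growth
  rate \<open>\<mu>\<close>. If the counts at some vertex were exponentially smaller than \<open>\<mu>\<^sup>n\<close> along infinitely
  many lengths \<open>n\<close>, the same would hold at its neighbours along the lengths \<open>2 * n\<close>, hence
  simultaneously at a representative of every orbit, a contradiction.

  Fisher transformation: a self-avoiding walk of \<open>F(G)\<close> crosses each new triangle in one or two
  steps, so up to effects at its two ends it is a self-avoiding walk of \<open>G\<close> each of whose steps
  is weighted \<open>x\<^sup>2 + x\<^sup>3\<close>. The generating function of \<open>F(G)\<close> at \<open>x\<close> and that of \<open>G\<close> at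
  \<open>x\<^sup>2 + x\<^sup>3\<close> thus converge together, and comparing radii of convergence gives (a).

  Part (b): \<open>1 / \<phi>\<close> is the positive fixed point of \<open>g\<close>, and \<open>g\<close> expands distances by at least
  \<open>7 / 4\<close> on \<open>[1/2, \<infinity>)\<close>, where all \<open>1 / \<mu>\<^sub>k\<close> lie because a cubic graph has \<open>\<mu> \<le> 2\<close>.
\<close>

section \<open>Self-avoiding walks with a forbidden set\<close>

text \<open>The start itself is tested against \<open>A\<close>, so the sum may run over all
  neighbours: those already visited contribute 0.\<close>

primrec saw_num :: "('a \<Rightarrow> 'a set) \<Rightarrow> nat \<Rightarrow> 'a \<Rightarrow> 'a set \<Rightarrow> nat" where
  "saw_num N 0 v A = (if v \<in> A then 0 else 1)"
| "saw_num N (Suc n) v A = (if v \<in> A then 0 else \<Sum>u\<in>N v. saw_num N n u (insert v A))"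

text \<open>The generating function of these counts, truncated at length \<open>M\<close> so that
  inequalities can be stated before any convergence is known.\<close>

definition saw_gf :: "('a \<Rightarrow> 'a set) \<Rightarrow> real \<Rightarrow> nat \<Rightarrow> 'a \<Rightarrow> 'a set \<Rightarrow> real" where
  "saw_gf N x M v A = (\<Sum>n\<le>M. real (saw_num N n v A) * x ^ n)"

lemma saw_num_forbidden [simp]: "v \<in> A \<Longrightarrow> saw_num N n v A = 0"
  by (cases n) auto

lemma saw_num_antimono: "A \<subseteq> B \<Longrightarrow> saw_num N n v B \<le> saw_num N n v A"
proof (induction n arbitrary: v A B)
  case (Suc n)
  have "saw_num N n u (insert v B) \<le> saw_num N n u (insert v A)" for u
    using Suc.IH[OF insert_mono[OF Suc.prems]] .
  then have "(\<Sum>u\<in>N v. saw_num N n u (insert v B)) \<le> (\<Sum>u\<in>N v. saw_num N n u (insert v A))"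
    by (rule sum_mono)
  then show ?case using Suc.prems by auto
qed auto

text \<open>Cut after \<open>n\<close> steps: the last \<open>m\<close> steps start at a vertex of
  \<open>V\<close>, and dropping their forbidden set can only increase the count.\<close>

lemma saw_num_add_le:
  assumes "\<And>u. u \<in> V \<Longrightarrow> real (saw_num N m u {}) \<le> c" and "\<And>u. u \<in> V \<Longrightarrow> N u \<subseteq> V" and "v \<in> V"
  shows "real (saw_num N (n + m) v A) \<le> real (saw_num N n v A) * c"
  using assms(3)
proof (induction n arbitrary: v A)
  case 0
  then show ?case
    using assms(1)[of v] saw_num_antimono[of "{}" A N m v] by (cases "v \<in> A") auto
next
  case (Suc n)
  have "(\<Sum>u\<in>N v. real (saw_num N (n + m) u (insert v A))) \<le>
      (\<Sum>u\<in>N v. real (saw_num N n u (insert v A)) * c)"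
    using Suc assms(2)[of v] by (intro sum_mono) blast
  then show ?case by (simp add: sum_distrib_right)
qed

text \<open>Walks through \<open>b\<close> are cut at their visit to \<open>b\<close>.\<close>

lemma saw_num_split:
  assumes "\<And>u. finite (N u)" and "v \<noteq> b"
  shows "saw_num N n v A \<le> saw_num N n v (insert b A) +
    (\<Sum>k<n. saw_num N k v (insert b A) * saw_num N (n - 1 - k) b A)"
  using assms(2)
proof (induction n arbitrary: v A)
  case (Suc n)
  show ?case
  proof (cases "v \<in> A")
    case False
    have term_le: "saw_num N n u (insert v A) \<le> (if u = b then saw_num N n b A else 0) +
        (saw_num N n u (insert v (insert b A)) +
         (\<Sum>k<n. saw_num N k u (insert v (insert b A)) * saw_num N (n - 1 - k) b A))" for u
    proof (cases "u = b")
      case True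
      then show ?thesis
        using saw_num_antimono[of A "insert v A" N n b] by auto
    next
      case False
      have "saw_num N n u (insert v A) \<le> saw_num N n u (insert b (insert v A)) +
        (\<Sum>k<n. saw_num N k u (insert b (insert v A)) * saw_num N (n - 1 - k) b (insert v A))"
        using Suc.IH[OF False] .
      also have "\<dots> \<le> saw_num N n u (insert b (insert v A)) +
        (\<Sum>k<n. saw_num N k u (insert b (insert v A)) * saw_num N (n - 1 - k) b A)"
        by (intro add_left_mono sum_mono mult_left_mono saw_num_antimono) auto
      finally show ?thesis by (simp add: insert_commute False)
    qed
    have "saw_num N (Suc n) v A \<le> (\<Sum>u\<in>N v. (if u = b then saw_num N n b A else 0) +
        (saw_num N n u (insert v (insert b A)) +
         (\<Sum>k<n. saw_num N k u (insert v (insert b A)) * saw_num N (n - 1 - k) b A)))"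
      using False sum_mono[where K = "N v", OF term_le] by (simp only: saw_num.simps if_False)
    also have "\<dots> = (if b \<in> N v then saw_num N n b A else 0) +
        (\<Sum>u\<in>N v. saw_num N n u (insert v (insert b A))) +
        (\<Sum>k<n. (\<Sum>u\<in>N v. saw_num N k u (insert v (insert b A))) * saw_num N (n - 1 - k) b A)"
      by (simp add: sum.distrib sum.delta[OF assms(1)] sum_distrib_right sum.swap[of _ "N v"])
    also have "\<dots> \<le> saw_num N n b A + saw_num N (Suc n) v (insert b A) +
        (\<Sum>k<n. saw_num N (Suc k) v (insert b A) * saw_num N (n - 1 - k) b A)"
      using False Suc.prems by auto
    also have "\<dots> = saw_num N (Suc n) v (insert b A) +
        (\<Sum>k<Suc n. saw_num N k v (insert b A) * saw_num N (Suc n - 1 - k) b A)"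
      using False Suc.prems by (subst sum.lessThan_Suc_shift) (simp del: saw_num.simps(2))
    finally show ?thesis .
  qed auto
qed auto

text \<open>Prefixing \<open>b\<close> turns a walk from \<open>u\<close> that avoids
  \<open>b\<close> into a walk from \<open>b\<close> with one more step. After the cut at
  \<open>b\<close>, counts at \<open>u\<close> are thus controlled by counts at \<open>b\<close>
  alone, which lets a deficit pass from \<open>b\<close> to \<open>u\<close>.\<close>

lemma saw_num_adjacent_le:
  assumes "\<And>u. finite (N u)" and "u \<noteq> b" and "u \<in> N b"
  shows "saw_num N n u {} \<le> saw_num N (Suc n) b {} +
    (\<Sum>k<n. saw_num N (Suc k) b {} * saw_num N (n - 1 - k) b {})"
proof -
  have le: "saw_num N k u {b} \<le> saw_num N (Suc k) b {}" for k
    using member_le_sum[OF assms(3) _ assms(1), of "\<lambda>u. saw_num N k u {b}"] by simp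
  have "saw_num N n u {} \<le> saw_num N n u {b} +
      (\<Sum>k<n. saw_num N k u {b} * saw_num N (n - 1 - k) b {})"
    using saw_num_split[OF assms(1,2), where A = "{}" and n = n] .
  also have "\<dots> \<le> saw_num N (Suc n) b {} +
      (\<Sum>k<n. saw_num N (Suc k) b {} * saw_num N (n - 1 - k) b {})"
    by (intro add_mono sum_mono mult_right_mono le) auto
  finally show ?thesis .
qed

text \<open>At most two of the three neighbours are available, and this persists: by symmetry the
  vertex just left is a forbidden neighbour of the next one.\<close>

lemma saw_num_le_power2:
  assumes "\<And>u. u \<in> V \<Longrightarrow> N u \<subseteq> V \<and> card (N u) = 3" and "\<And>u v. v \<in> N u \<Longrightarrow> u \<in> N v"
    and "v \<in> V" and "N v \<inter> A \<noteq> {}"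
  shows "saw_num N n v A \<le> 2 ^ n"
  using assms(3,4)
proof (induction n arbitrary: v A)
  case (Suc n)
  obtain a where a: "a \<in> N v" "a \<in> A" using Suc.prems by auto
  have card: "card (N v - {a}) = 2" and fin: "finite (N v)"
    using assms(1)[OF Suc.prems(1)] a by (auto simp: card.infinite intro: card_ge_0_finite)
  have "(\<Sum>u\<in>N v. saw_num N n u (insert v A)) = (\<Sum>u\<in>N v - {a}. saw_num N n u (insert v A))"
    using a fin by (subst sum.remove[of _ a]) auto
  also have "\<dots> \<le> (\<Sum>u\<in>N v - {a}. 2 ^ n)"
    using Suc.IH assms(1)[OF Suc.prems(1)] assms(2) by (intro sum_mono) blast
  also have "\<dots> = 2 ^ Suc n" using card by simp
  finally show ?case by simp
qed auto

lemma saw_num_image: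
  assumes "inj_on f V" and "\<And>u. u \<in> V \<Longrightarrow> N u \<subseteq> V" and "\<And>u. u \<in> V \<Longrightarrow> N' (f u) = f ` N u"
    and "v \<in> V" and "A \<subseteq> V"
  shows "saw_num N' n (f v) (f ` A) = saw_num N n v A"
  using assms(4,5)
proof (induction n arbitrary: v A)
  case 0
  then show ?case using assms(1) by (auto simp: inj_on_image_mem_iff)
next
  case (Suc n)
  have mem: "f v \<in> f ` A \<longleftrightarrow> v \<in> A"
    using Suc.prems assms(1) by (auto simp: inj_on_image_mem_iff)
  have "(\<Sum>u\<in>f ` N v. saw_num N' n u (insert (f v) (f ` A))) =
      (\<Sum>u\<in>N v. saw_num N' n (f u) (f ` insert v A))"
    using inj_on_subset[OF assms(1) assms(2)[OF Suc.prems(1)]] by (simp add: sum.reindex)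
  also have "\<dots> = (\<Sum>u\<in>N v. saw_num N n u (insert v A))"
    using Suc.prems assms(2)[OF Suc.prems(1)] by (intro sum.cong refl Suc.IH) auto
  finally show ?case using mem Suc.prems assms(3) by simp
qed

section \<open>Truncated generating functions\<close>

lemma saw_gf_Suc:
  "saw_gf N x (Suc M) v A =
    (if v \<in> A then 0 else 1 + x * (\<Sum>u\<in>N v. saw_gf N x M u (insert v A)))"
proof (cases "v \<in> A")
  case True
  then show ?thesis by (simp add: saw_gf_def del: saw_num.simps)
next
  case False
  have "(\<Sum>n\<le>M. real (\<Sum>u\<in>N v. saw_num N n u (insert v A)) * x ^ Suc n)
      = x * (\<Sum>u\<in>N v. saw_gf N x M u (insert v A))"
    unfolding saw_gf_def
    by (subst sum.swap) (simp add: sum_distrib_left sum_distrib_right mult_ac)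
  with False show ?thesis
    unfolding saw_gf_def by (subst sum.atMost_Suc_shift) simp
qed

lemma saw_gf_0: "saw_gf N x 0 v A = (if v \<in> A then 0 else 1)"
  by (simp add: saw_gf_def)

lemma saw_gf_forbidden [simp]: "v \<in> A \<Longrightarrow> saw_gf N x M v A = 0"
  by (simp add: saw_gf_def)

lemma saw_gf_nonneg: "0 \<le> x \<Longrightarrow> 0 \<le> saw_gf N x M v A"
  by (auto simp: saw_gf_def intro!: sum_nonneg)

lemma saw_gf_antimono: "0 \<le> x \<Longrightarrow> A \<subseteq> B \<Longrightarrow> saw_gf N x M v B \<le> saw_gf N x M v A"
  by (auto simp: saw_gf_def intro!: sum_mono mult_right_mono saw_num_antimono)

lemma saw_gf_mono: "0 \<le> x \<Longrightarrow> M \<le> M' \<Longrightarrow> saw_gf N x M v A \<le> saw_gf N x M' v A"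
  unfolding saw_gf_def by (intro sum_mono2) auto

text \<open>Raising the truncation only adds nonnegative terms, so the recursion becomes an
  inequality with the same \<open>M\<close> on both sides. Several steps can then be unfolded
  without tracking \<open>M\<close>.\<close>

lemma saw_gf_le_step:
  assumes "0 \<le> x"
  shows "saw_gf N x M v A \<le> 1 + x * (\<Sum>u\<in>N v. saw_gf N x M u (insert v A))"
proof -
  have "saw_gf N x M v A \<le> saw_gf N x (Suc M) v A" using assms by (simp add: saw_gf_mono)
  also have "\<dots> \<le> 1 + x * (\<Sum>u\<in>N v. saw_gf N x M u (insert v A))"
    using assms by (auto simp: saw_gf_Suc intro!: add_nonneg_nonneg mult_nonneg_nonneg sum_nonneg saw_gf_nonneg)
  finally show ?thesis .
qed

text \<open>A walk either avoids \<open>b\<close> or consists of a walk avoiding \<open>b\<close>,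
  one edge of weight \<open>x\<close> into \<open>b\<close>, and a walk from
  \<open>b\<close>.\<close>

lemma saw_gf_split:
  assumes "0 \<le> x" and "\<And>u. finite (N u)" and "v \<noteq> b"
  shows "saw_gf N x M v A \<le> saw_gf N x M v (insert b A) * (1 + x * saw_gf N x M b A)"
  using assms(3)
proof (induction M arbitrary: v A)
  case 0
  then show ?case using assms(1) saw_gf_nonneg[of x] by (auto simp: saw_gf_0)
next
  case (Suc M)
  \<comment> \<open>Taken at the truncation \<open>Suc M\<close>, \<open>c\<close> also dominates
    the factors that the induction hypothesis yields at \<open>M\<close>.\<close>
  define c where "c = 1 + x * saw_gf N x (Suc M) b A"
  have c: "saw_gf N x M b A \<le> saw_gf N x (Suc M) b A" "1 \<le> c"
    using assms(1) saw_gf_mono[of x M "Suc M"] saw_gf_nonneg[OF assms(1), of N "Suc M" b A]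
    by (auto simp: c_def)
  show ?case
  proof (cases "v \<in> A")
    case False
    have term_le: "saw_gf N x M u (insert v A) \<le> (if u = b then saw_gf N x (Suc M) b A else 0) +
        saw_gf N x M u (insert v (insert b A)) * c" for u
    proof (cases "u = b")
      case True
      then show ?thesis
        using saw_gf_antimono[OF assms(1), of A "insert v A" N M b] c by (simp add: subset_insertI)
    next
      case False
      have "saw_gf N x M u (insert v A) \<le>
          saw_gf N x M u (insert b (insert v A)) * (1 + x * saw_gf N x M b (insert v A))"
        using Suc.IH[OF False] .
      also have "\<dots> \<le> saw_gf N x M u (insert b (insert v A)) * c"
        unfolding c_def using assms(1) c(1) saw_gf_antimono[OF assms(1) subset_insertI[of A v], of N M b]
        by (intro mult_left_mono add_left_mono saw_gf_nonneg) auto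
      finally show ?thesis by (simp add: insert_commute False)
    qed
    have "(\<Sum>u\<in>N v. saw_gf N x M u (insert v A)) \<le>
        (\<Sum>u\<in>N v. (if u = b then saw_gf N x (Suc M) b A else 0) +
          saw_gf N x M u (insert v (insert b A)) * c)"
      by (intro sum_mono term_le)
    also have "\<dots> \<le> saw_gf N x (Suc M) b A + (\<Sum>u\<in>N v. saw_gf N x M u (insert v (insert b A))) * c"
      using saw_gf_nonneg[OF assms(1), of N "Suc M" b A]
      by (simp add: sum.distrib sum.delta[OF assms(2)] sum_distrib_right)
    finally have "1 + x * (\<Sum>u\<in>N v. saw_gf N x M u (insert v A)) \<le>
        1 + x * (saw_gf N x (Suc M) b A + (\<Sum>u\<in>N v. saw_gf N x M u (insert v (insert b A))) * c)"
      using assms(1) by (simp add: mult_left_mono)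
    also have "\<dots> = c * (1 + x * (\<Sum>u\<in>N v. saw_gf N x M u (insert v (insert b A))))"
      by (simp add: c_def algebra_simps)
    finally have "saw_gf N x (Suc M) v A \<le> c * saw_gf N x (Suc M) v (insert b A)"
      using False Suc.prems by (simp add: saw_gf_Suc)
    then show ?thesis by (simp add: c_def mult.commute)
  qed auto
qed

section \<open>Existence of the growth rate\<close>

text \<open>Fekete's argument: \<open>\<mu>\<close> is the infimum of the \<open>n\<close>-th roots.
  For \<open>\<rho>\<close> above it some length \<open>p\<close> already has its root below
  \<open>\<rho>\<close>, and division by \<open>p\<close> with remainder carries this to all
  lengths.\<close>

lemma submultiplicative_growth:
  fixes c :: "nat \<Rightarrow> real"
  assumes ge1: "\<And>n. 1 \<le> c n" and sub: "\<And>m n. c (m + n) \<le> c m * c n"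
  obtains \<mu> where "1 \<le> \<mu>" and "\<And>n. \<mu> ^ n \<le> c n"
    and "\<And>\<rho>. \<mu> < \<rho> \<Longrightarrow> \<exists>A\<ge>1. \<forall>n. c n \<le> A * \<rho> ^ n"
proof -
  \<comment> \<open>Length 0 is left out: \<open>root 0\<close> is constantly 0 and would spoil the
    infimum.\<close>
  define S where "S = (\<lambda>n. root n (c n)) ` {1..}"
  define \<mu> where "\<mu> = Inf S"
  have S1: "1 \<le> s" if "s \<in> S" for s
    using that ge1 by (auto simp: S_def)
  have bdd: "bdd_below S" using S1 by (rule bdd_belowI)
  have ne: "S \<noteq> {}" by (auto simp: S_def)
  have mu1: "1 \<le> \<mu>" unfolding \<mu>_def using S1 ne by (intro cInf_greatest)
  have lower: "\<mu> ^ n \<le> c n" for n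
  proof (cases "n = 0")
    case False
    then have "\<mu> \<le> root n (c n)"
      unfolding \<mu>_def by (intro cInf_lower[OF _ bdd]) (auto simp: S_def)
    then have "\<mu> ^ n \<le> root n (c n) ^ n" using mu1 by (intro power_mono) auto
    also have "\<dots> = c n" using False ge1[of n] by simp
    finally show ?thesis .
  qed (use ge1[of 0] in auto)
  have upper: "\<exists>A\<ge>1. \<forall>n. c n \<le> A * \<rho> ^ n" if rho: "\<mu> < \<rho>" for \<rho>
  proof -
    obtain s where "s \<in> S" "s < \<rho>" using cInf_lessD[OF ne, of \<rho>] rho unfolding \<mu>_def by blast
    then obtain p where p: "1 \<le> p" "root p (c p) < \<rho>" by (auto simp: S_def)
    have "root p (c p) ^ p \<le> \<rho> ^ p" using p ge1[of p] by (intro power_mono) auto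
    then have cp: "c p \<le> \<rho> ^ p" using p ge1[of p] by simp
    \<comment> \<open>Bounds the factor that belongs to the remainder
      \<open>n mod p\<close>.\<close>
    define A where "A = (\<Sum>i<p. c i)"
    have le_A: "c i \<le> A" if "i < p" for i
      unfolding A_def using that ge1 by (intro member_le_sum) (auto intro: order_trans[of 0 1])
    then have A1: "1 \<le> A" using p ge1[of 0] by (intro order_trans[OF ge1[of 0]]) auto
    have mult: "c (q * p + i) \<le> \<rho> ^ (q * p) * c i" for q i
    proof (induction q)
      case (Suc q)
      have "c (Suc q * p + i) \<le> c p * c (q * p + i)"
        using sub[of p "q * p + i"] by (simp add: add.assoc)
      also have "\<dots> \<le> \<rho> ^ p * (\<rho> ^ (q * p) * c i)"
        using cp Suc ge1[of p] ge1[of "q * p + i"] by (intro mult_mono) auto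
      finally show ?case by (simp add: power_add mult_ac)
    qed auto
    have "c n \<le> A * \<rho> ^ n" for n
    proof -
      have "c n \<le> \<rho> ^ (n div p * p) * c (n mod p)" using mult[of "n div p" "n mod p"] by simp
      also have "\<dots> \<le> \<rho> ^ n * A"
        using mu1 rho p A1 ge1[of "n mod p"] by (intro mult_mono le_A power_increasing) auto
      finally show ?thesis by (simp add: mult.commute)
    qed
    with A1 show ?thesis by blast
  qed
  show ?thesis using that mu1 lower upper by blast
qed

text \<open>A slightly larger base absorbs constants and the linear number of places at which a walk
  can be cut.\<close>

lemma eventually_linear_times_power_le:
  fixes a b q q' :: real
  assumes "0 < q" and "q < q'"
  shows "eventually (\<lambda>n. (a + b * real n) * q ^ n \<le> q' ^ n) sequentially"
proof -
  have t: "norm (q / q') < 1" using assms by simp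
  have "(\<lambda>n. a * (q / q') ^ n + b * (real n * (q / q') ^ n)) \<longlonglongrightarrow> a * 0 + b * 0"
    by (intro tendsto_add tendsto_mult tendsto_const LIMSEQ_power_zero[OF t] powser_times_n_limit_0[OF t])
  then have "eventually (\<lambda>n. a * (q / q') ^ n + b * (real n * (q / q') ^ n) < 1) sequentially"
    by (rule order_tendstoD) simp
  then show ?thesis
  proof eventually_elim
    case (elim n)
    then show ?case using assms by (simp add: field_simps power_divide)
  qed
qed

text \<open>A graph is seen through its neighbourhoods only, so that \<open>G\<close>, its
  relabelled copy and all Fisher graphs are treated alike. Automorphisms appear in the form in which
  \<open>saw_num_image\<close> uses them.\<close>

locale cubic_system =
  fixes V :: "'a set" and N :: "'a \<Rightarrow> 'a set"
  assumes closed: "v \<in> V \<Longrightarrow> N v \<subseteq> V"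
    and finite_N: "finite (N v)"
    and card_N: "v \<in> V \<Longrightarrow> card (N v) = 3"
    and irrefl: "v \<notin> N v"
    and sym: "u \<in> N v \<Longrightarrow> v \<in> N u"
    and infinite_V: "infinite V"
    and connected: "u \<in> V \<Longrightarrow> v \<in> V \<Longrightarrow> (u, v) \<in> {(a, b). b \<in> N a}\<^sup>*"
    and finitely_many_orbits: "\<exists>W. finite W \<and> W \<subseteq> V \<and> (\<forall>v\<in>V. \<exists>f. inj_on f V \<and>
      (\<forall>u\<in>V. f u \<in> V \<and> N (f u) = f ` N u) \<and> f v \<in> W)"
begin

text \<open>Only the vertices after the start must avoid \<open>A\<close>; \<open>v\<close> always
  belongs to its own set.\<close>

definition reach :: "'a set \<Rightarrow> 'a \<Rightarrow> 'a set" where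
  "reach A v = {u. (v, u) \<in> {(a, b). b \<in> N a \<and> b \<notin> A}\<^sup>*}"

text \<open>Cut a walk after its last visit to \<open>v\<close>: the rest starts at a neighbour and
  avoids \<open>v\<close> too.\<close>

lemma reach_subset: "reach A v \<subseteq> insert v (\<Union>u\<in>N v - insert v A. reach (insert v A) u)"
proof
  fix x assume "x \<in> reach A v"
  then have "(v, x) \<in> {(a, b). b \<in> N a \<and> b \<notin> A}\<^sup>*" by (simp add: reach_def)
  then show "x \<in> insert v (\<Union>u\<in>N v - insert v A. reach (insert v A) u)"
  proof (induction rule: rtrancl_induct)
    case (step y z)
    show ?case
    proof (cases "z = v")
      case False
      show ?thesis
      proof (cases "y = v")
        case True
        have "z \<in> reach (insert v A) z" by (simp add: reach_def)
        then show ?thesis using True False step.hyps by auto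
      next
        case False
        then obtain u where u: "u \<in> N v - insert v A" "y \<in> reach (insert v A) u"
          using step.IH by auto
        have "z \<in> reach (insert v A) u"
          using u(2) step.hyps \<open>z \<noteq> v\<close> unfolding reach_def
          by (auto intro: rtrancl.rtrancl_into_rtrancl)
        then show ?thesis using u by blast
      qed
    qed auto
  qed auto
qed

text \<open>Koenig's argument: as \<open>v\<close> has finitely many neighbours, one of them still
  reaches infinitely many vertices without using \<open>v\<close>.\<close>

lemma saw_num_pos_if_infinite_reach:
  "v \<notin> A \<Longrightarrow> infinite (reach A v) \<Longrightarrow> 1 \<le> saw_num N n v A"
proof (induction n arbitrary: v A)
  case (Suc n)
  have "infinite (\<Union>u\<in>N v - insert v A. reach (insert v A) u)"
    using Suc.prems(2) reach_subset[of A v] by (meson finite_insert infinite_super)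
  then obtain u where u: "u \<in> N v - insert v A" "infinite (reach (insert v A) u)"
    using finite_N[of v] by blast
  then have "1 \<le> saw_num N n u (insert v A)" using Suc.IH by blast
  also have "\<dots> \<le> (\<Sum>u\<in>N v. saw_num N n u (insert v A))"
    using u finite_N by (intro member_le_sum) auto
  finally show ?case using Suc.prems by simp
qed auto

lemma saw_num_pos: "v \<in> V \<Longrightarrow> 1 \<le> saw_num N n v {}"
proof -
  assume v: "v \<in> V"
  then have "V \<subseteq> reach {} v" using connected by (auto simp: reach_def)
  then show ?thesis
    using infinite_V by (intro saw_num_pos_if_infinite_reach) (auto dest: finite_subset)
qed

lemma saw_num_le: "v \<in> V \<Longrightarrow> saw_num N n v {} \<le> 3 * 2 ^ n"
proof (cases n)
  case (Suc m)
  assume v: "v \<in> V"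
  have "saw_num N m u {v} \<le> 2 ^ m" if "u \<in> N v" for u
    using saw_num_le_power2[of V N u "{v}" m] closed card_N sym v that by blast
  then have "(\<Sum>u\<in>N v. saw_num N m u {v}) \<le> (\<Sum>u\<in>N v. 2 ^ m)" by (intro sum_mono)
  then show ?thesis using card_N[OF v] Suc by simp
qed auto

text \<open>The deficit that is to be refuted. The length \<open>n\<close> is common to all vertices
  of \<open>S\<close>; once \<open>S\<close> contains all orbit representatives, this bounds the
  maximal count itself.\<close>

definition thin :: "real \<Rightarrow> 'a set \<Rightarrow> bool" where
  "thin \<mu> S \<longleftrightarrow> (\<exists>r>0. r < \<mu> \<and> (\<forall>K. \<exists>n\<ge>K. \<forall>w\<in>S. real (saw_num N n w {}) \<le> r ^ n))"

text \<open>A walk of length \<open>2 * n\<close> from \<open>u\<close> is cut at \<open>v\<close>; one of the pieces has length at least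
  \<open>n\<close> and therefore inherits the deficit at \<open>v\<close>. Doubling the lengths keeps the deficit of the
  other vertices of \<open>S\<close>.\<close>

lemma thin_insert_neighbour:
  assumes mu: "1 \<le> \<mu>"
    and upper: "\<And>\<rho>. \<mu> < \<rho> \<Longrightarrow> \<exists>A\<ge>1. \<forall>n. \<forall>v\<in>V. real (saw_num N n v {}) \<le> A * \<rho> ^ n"
    and S: "S \<subseteq> V" "thin \<mu> S" "v \<in> S" "u \<in> N v"
  shows "thin \<mu> (insert u S)"
proof -
  obtain r where r: "0 < r" "r < \<mu>"
    and inf: "\<And>K. \<exists>n\<ge>K. \<forall>w\<in>S. real (saw_num N n w {}) \<le> r ^ n"
    using S(2) unfolding thin_def by blast
  \<comment> \<open>\<open>\<rho>\<close> is taken so close to \<open>\<mu>\<close> that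
    \<open>r * \<rho> < \<mu> * \<mu>\<close>; the geometric mean \<open>q\<close> of
    \<open>r\<close> and \<open>\<rho>\<close> then stays below \<open>\<mu>\<close>, and
    \<open>q'\<close> leaves room for the linear factor.\<close>
  have "\<mu> < \<mu> * \<mu> / r" using r mu by (simp add: field_simps)
  then obtain \<rho> where rho: "\<mu> < \<rho>" "\<rho> < \<mu> * \<mu> / r" using dense by blast
  obtain A where A: "1 \<le> A" "\<And>n v. v \<in> V \<Longrightarrow> real (saw_num N n v {}) \<le> A * \<rho> ^ n"
    using upper[OF rho(1)] by blast
  define q where "q = sqrt (r * \<rho>)"
  have q2: "q ^ 2 = r * \<rho>" using r rho mu by (simp add: q_def)
  have q0: "0 < q" using r rho mu by (simp add: q_def)
  have "q < sqrt (\<mu> * \<mu>)"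
    unfolding q_def using rho(2) r by (intro real_sqrt_less_mono) (simp add: field_simps)
  then have "q < \<mu>" using mu by simp
  then obtain q' where q': "q < q'" "q' < \<mu>" using dense by blast
  obtain K0 where K0: "\<And>n. K0 \<le> n \<Longrightarrow> (A * \<rho> + A * A * real n) * q ^ n \<le> q' ^ n"
    using eventually_linear_times_power_le[OF q0 q'(1), of "A * \<rho>" "A * A"]
    unfolding eventually_sequentially by blast
  have "\<exists>m\<ge>K. \<forall>w\<in>insert u S. real (saw_num N m w {}) \<le> q' ^ m" for K
  proof -
    obtain n where n: "n \<ge> max K K0" "\<And>w. w \<in> S \<Longrightarrow> real (saw_num N n w {}) \<le> r ^ n"
      using inf by blast
    have rq: "r ^ n * \<rho> ^ n = q ^ (2 * n)" by (simp add: power_mult q2 power_mult_distrib)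
    \<comment> \<open>The first \<open>n\<close> steps carry the deficit, the remaining ones grow at
      the general rate \<open>\<rho>\<close>.\<close>
    have tail: "real (saw_num N k w {}) \<le> A * (r ^ n * \<rho> ^ (k - n))" if "w \<in> S" "n \<le> k" for w k
    proof -
      have "real (saw_num N (n + (k - n)) w {}) \<le> real (saw_num N n w {}) * (A * \<rho> ^ (k - n))"
        using that S(1) closed by (intro saw_num_add_le[where V = V] A) auto
      also have "\<dots> \<le> r ^ n * (A * \<rho> ^ (k - n))"
        using n(2)[OF that(1)] A(1) rho(1) mu by (intro mult_right_mono) auto
      finally show ?thesis using that(2) by (simp add: mult_ac)
    qed
    have prod: "real (saw_num N i v {}) * real (saw_num N j v {}) \<le> A * A * q ^ (2 * n)"
      if ij: "i + j = 2 * n" "n \<le> i" for i j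
    proof -
      have "real (saw_num N i v {}) * real (saw_num N j v {}) \<le>
          (A * (r ^ n * \<rho> ^ (i - n))) * (A * \<rho> ^ j)"
        using ij S A r rho mu by (intro mult_mono tail A(2)) auto
      also have "\<dots> = A * A * (r ^ n * \<rho> ^ ((i - n) + j))" by (simp add: power_add mult_ac)
      also have "(i - n) + j = n" using ij by simp
      finally show ?thesis by (simp add: rq)
    qed
    have bound: "(A * \<rho> + A * A * real (2 * n)) * q ^ (2 * n) \<le> q' ^ (2 * n)"
      using n(1) by (intro K0) auto
    have old: "real (saw_num N (2 * n) w {}) \<le> q' ^ (2 * n)" if "w \<in> S" for w
    proof -
      have "real (saw_num N (2 * n) w {}) \<le> A * q ^ (2 * n)"
        using tail[OF that, of "2 * n"] rq by simp
      also have "\<dots> \<le> (A * \<rho> + A * A * real (2 * n)) * q ^ (2 * n)"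
      proof (rule mult_right_mono)
        have "A * 1 \<le> A * \<rho>" using A mu rho by (intro mult_left_mono) auto
        moreover have "0 \<le> A * A * real (2 * n)" using A by simp
        ultimately show "A \<le> A * \<rho> + A * A * real (2 * n)" by linarith
      qed (use q0 in auto)
      finally show ?thesis using bound by linarith
    qed
    have "u \<noteq> v" using S(4) irrefl by blast
    then have "saw_num N (2 * n) u {} \<le> saw_num N (Suc (2 * n)) v {} +
        (\<Sum>k<2 * n. saw_num N (Suc k) v {} * saw_num N (2 * n - 1 - k) v {})"
      using saw_num_adjacent_le[of N u v "2 * n"] finite_N S(4) by blast
    then have "real (saw_num N (2 * n) u {}) \<le> real (saw_num N (Suc (2 * n)) v {} +
        (\<Sum>k<2 * n. saw_num N (Suc k) v {} * saw_num N (2 * n - 1 - k) v {}))"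
      by (rule of_nat_mono)
    also have "\<dots> = real (saw_num N (Suc (2 * n)) v {}) +
        (\<Sum>k<2 * n. real (saw_num N (Suc k) v {}) * real (saw_num N (2 * n - 1 - k) v {}))"
      by (simp del: saw_num.simps)
    also have "\<dots> \<le> A * \<rho> * q ^ (2 * n) + (\<Sum>k<2 * n. A * A * q ^ (2 * n))"
    proof (intro add_mono sum_mono)
      \<comment> \<open>The uncut walks, prefixed by \<open>v\<close>, have length
        \<open>2 * n + 1\<close>; the odd step costs the extra factor \<open>\<rho>\<close>.\<close>
      have "Suc (2 * n) - n = Suc n" by simp
      then show "real (saw_num N (Suc (2 * n)) v {}) \<le> A * \<rho> * q ^ (2 * n)"
        using tail[OF S(3), of "Suc (2 * n)"] rq[symmetric] by (simp add: mult_ac del: saw_num.simps)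
    next
      fix k assume k: "k \<in> {..<2 * n}"
      show "real (saw_num N (Suc k) v {}) * real (saw_num N (2 * n - 1 - k) v {})
          \<le> A * A * q ^ (2 * n)"
      proof (cases "n \<le> Suc k")
        case True
        then show ?thesis using k by (intro prod) auto
      next
        case False
        then show ?thesis
          using prod[of "2 * n - 1 - k" "Suc k"] k by (simp add: mult.commute del: saw_num.simps)
      qed
    qed
    also have "\<dots> = (A * \<rho> + A * A * real (2 * n)) * q ^ (2 * n)" by (simp add: algebra_simps)
    also note bound
    finally have "\<forall>w\<in>insert u S. real (saw_num N (2 * n) w {}) \<le> q' ^ (2 * n)"
      using old by blast
    then show ?thesis using n(1) by (intro exI[of _ "2 * n"]) auto
  qed
  then show ?thesis unfolding thin_def using q0 q' by (intro exI[of _ q']) auto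
qed

text \<open>By connectedness each vertex of \<open>W\<close> is joined to \<open>v\<close> by a
  path; its vertices are added one after the other, and the set reached so far keeps its
  deficit.\<close>

lemma thin_extend:
  assumes mu: "1 \<le> \<mu>"
    and upper: "\<And>\<rho>. \<mu> < \<rho> \<Longrightarrow> \<exists>A\<ge>1. \<forall>n. \<forall>v\<in>V. real (saw_num N n v {}) \<le> A * \<rho> ^ n"
    and v: "v \<in> V" "thin \<mu> {v}" and W: "finite W" "W \<subseteq> V"
  shows "\<exists>S. insert v W \<subseteq> S \<and> S \<subseteq> V \<and> thin \<mu> S"
  using W
proof (induction W rule: finite_induct)
  case (insert w W)
  then obtain S where S: "insert v W \<subseteq> S" "S \<subseteq> V" "thin \<mu> S" by auto
  have "(v, w) \<in> {(a, b). b \<in> N a}\<^sup>*" using connected v insert.prems by blast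
  then have "\<exists>S'. insert w S \<subseteq> S' \<and> S' \<subseteq> V \<and> thin \<mu> S'"
  proof (induction rule: rtrancl_induct)
    case base
    then show ?case using S by blast
  next
    case (step y z)
    then obtain S' where S': "insert y S \<subseteq> S'" "S' \<subseteq> V" "thin \<mu> S'" by blast
    have "thin \<mu> (insert z S')" using S' step by (intro thin_insert_neighbour[OF mu upper]) auto
    moreover have "insert z S' \<subseteq> V" using S' closed step by blast
    ultimately show ?case using S' by (intro exI[of _ "insert z S'"]) auto
  qed
  then obtain S' where "insert w S \<subseteq> S'" "S' \<subseteq> V" "thin \<mu> S'" by blast
  then show ?case using S by (intro exI[of _ S']) auto
qed (use v in blast)

text \<open>The upper estimate at every vertex comes from submultiplicativity of the maximal count,
  the lower one from the impossibility of a deficit; the bound 2 holds because a walk never steps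
  back.\<close>

theorem saw_num_growth:
  obtains \<mu> where "1 \<le> \<mu>" and "\<mu> \<le> 2"
    and "\<And>v. v \<in> V \<Longrightarrow> (\<lambda>n. root n (real (saw_num N n v {}))) \<longlonglongrightarrow> \<mu>"
proof -
  obtain W where W: "finite W" "W \<subseteq> V" "\<forall>v\<in>V. \<exists>f. inj_on f V \<and>
      (\<forall>u\<in>V. f u \<in> V \<and> N (f u) = f ` N u) \<and> f v \<in> W"
    using finitely_many_orbits by blast
  have ne: "W \<noteq> {}" using W(3) infinite_V by fastforce
  \<comment> \<open>Counts are constant on orbits, so this maximum over representatives is one over
    all of \<open>V\<close>.\<close>
  define c where "c n = Max ((\<lambda>w. real (saw_num N n w {})) ` W)" for n
  have le_c: "real (saw_num N n v {}) \<le> c n" if v: "v \<in> V" for n v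
  proof -
    obtain f where f: "inj_on f V" "\<forall>u\<in>V. f u \<in> V \<and> N (f u) = f ` N u" "f v \<in> W"
      using W(3) v by blast
    have "saw_num N n v {} = saw_num N n (f v) {}"
      using saw_num_image[of f V N N v "{}" n] f closed v by auto
    then show ?thesis unfolding c_def using f W by (auto intro!: Max_ge)
  qed
  have c_attained: "\<exists>w\<in>W. c n = real (saw_num N n w {})" for n
  proof -
    have "c n \<in> (\<lambda>w. real (saw_num N n w {})) ` W"
      unfolding c_def using W(1) ne by (intro Max_in) auto
    then show ?thesis by auto
  qed
  have c1: "1 \<le> c n" for n
    using c_attained[of n] saw_num_pos[of _ n] W(2) by fastforce
  have c_sub: "c (m + n) \<le> c m * c n" for m n
  proof -
    obtain w where w: "w \<in> W" "c (m + n) = real (saw_num N (m + n) w {})"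
      using c_attained by blast
    have "c (m + n) \<le> real (saw_num N m w {}) * c n"
      unfolding w(2) using w W closed by (intro saw_num_add_le[where V = V] le_c) auto
    also have "\<dots> \<le> c m * c n" using w W c1[of n] by (intro mult_right_mono le_c) auto
    finally show ?thesis .
  qed
  obtain \<mu> where mu: "1 \<le> \<mu>" and lower: "\<And>n. \<mu> ^ n \<le> c n"
    and upper: "\<And>\<rho>. \<mu> < \<rho> \<Longrightarrow> \<exists>A\<ge>1. \<forall>n. c n \<le> A * \<rho> ^ n"
    using submultiplicative_growth[of c] c1 c_sub by blast
  have upper': "\<exists>A\<ge>1. \<forall>n. \<forall>v\<in>V. real (saw_num N n v {}) \<le> A * \<rho> ^ n" if "\<mu> < \<rho>" for \<rho>
    using upper[OF that] le_c by (meson order_trans)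
  have not_thin: "\<not> thin \<mu> {v}" if v: "v \<in> V" for v
  proof
    assume "thin \<mu> {v}"
    then obtain S where S: "insert v W \<subseteq> S" "thin \<mu> S"
      using thin_extend[OF mu upper' v _ W(1,2)] by blast
    then obtain r n where r: "0 < r" "r < \<mu>" "1 \<le> n" "\<forall>w\<in>S. real (saw_num N n w {}) \<le> r ^ n"
      unfolding thin_def by blast
    obtain w where "w \<in> W" "c n = real (saw_num N n w {})" using c_attained by blast
    then have "c n \<le> r ^ n" using r S by auto
    also have "\<dots> < \<mu> ^ n" using r by (intro power_strict_mono) auto
    finally show False using lower[of n] by simp
  qed
  have "\<mu> \<le> 2"
  proof (rule ccontr)
    assume "\<not> \<mu> \<le> 2"
    then obtain n where n: "3 < (\<mu> / 2) ^ n" using real_arch_pow[of "\<mu> / 2" 3] by auto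
    obtain w where w: "w \<in> W" "c n = real (saw_num N n w {})" using c_attained by blast
    have "real (saw_num N n w {}) \<le> real (3 * 2 ^ n)"
      using saw_num_le w W by (intro of_nat_mono) auto
    then have "\<mu> ^ n \<le> 3 * 2 ^ n" using w lower[of n] by simp
    then show False using n by (simp add: power_divide field_simps)
  qed
  moreover have "(\<lambda>n. root n (real (saw_num N n v {}))) \<longlonglongrightarrow> \<mu>" if v: "v \<in> V" for v
  proof (rule order_tendstoI)
    fix r assume r: "r < \<mu>"
    show "eventually (\<lambda>n. r < root n (real (saw_num N n v {}))) sequentially"
    proof (cases "0 < r")
      case True
      then have "\<not> (\<forall>K. \<exists>n\<ge>K. real (saw_num N n v {}) \<le> r ^ n)"
        using not_thin[OF v] r unfolding thin_def by auto
      then obtain K where K: "\<And>n. K \<le> n \<Longrightarrow> r ^ n < real (saw_num N n v {})"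
        by (meson not_le)
      have "r < root n (real (saw_num N n v {}))" if "max K 1 \<le> n" for n
      proof -
        have "root n (r ^ n) < root n (real (saw_num N n v {}))"
          using K[of n] that by (intro real_root_less_mono) auto
        then show ?thesis using True that by (simp add: real_root_power_cancel)
      qed
      then show ?thesis unfolding eventually_sequentially by blast
    next
      case False
      have "r < root n (real (saw_num N n v {}))" if "1 \<le> n" for n
      proof -
        have "0 < root n (real (saw_num N n v {}))"
          using saw_num_pos[OF v, of n] that by (intro real_root_gt_zero) auto
        then show ?thesis using False by linarith
      qed
      then show ?thesis unfolding eventually_sequentially by blast
    qed
  next
    fix \<rho> assume "\<mu> < \<rho>"
    \<comment> \<open>Two intermediate rates: \<open>\<rho>'\<close> gives a bound with a constant
      \<open>A\<close>, and \<open>\<rho>''\<close> absorbs that constant.\<close>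
    then obtain \<rho>' where rho: "\<mu> < \<rho>'" "\<rho>' < \<rho>" using dense by blast
    then obtain \<rho>'' where rho'': "\<rho>' < \<rho>''" "\<rho>'' < \<rho>" using dense by blast
    obtain A where A: "\<And>n. real (saw_num N n v {}) \<le> A * \<rho>' ^ n"
      using upper'[OF rho(1)] v by blast
    have "eventually (\<lambda>n. (A + 0 * real n) * \<rho>' ^ n \<le> \<rho>'' ^ n) sequentially"
      using rho rho'' mu by (intro eventually_linear_times_power_le) auto
    then show "eventually (\<lambda>n. root n (real (saw_num N n v {})) < \<rho>) sequentially"
      using eventually_ge_at_top[of 1]
    proof eventually_elim
      case (elim n)
      have "root n (real (saw_num N n v {})) \<le> root n (\<rho>'' ^ n)"
        using A[of n] elim by (intro real_root_le_mono) auto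
      also have "\<dots> = \<rho>''" using elim rho rho'' mu by (intro real_root_power_cancel) auto
      finally show ?case using rho'' by linarith
    qed
  qed
  ultimately show ?thesis using that mu by blast
qed

end

section \<open>Graphs and their neighbourhoods\<close>

definition nbrs :: "'a ugraph \<Rightarrow> 'a \<Rightarrow> 'a set" where
  "nbrs G v = {u. {v, u} \<in> edges G}"

lemma nbrs_sym: "u \<in> nbrs G v \<longleftrightarrow> v \<in> nbrs G u"
  by (simp add: nbrs_def insert_commute)

lemma simple_graph_nbrs:
  assumes "simple_graph G" and "u \<in> nbrs G v"
  shows "u \<in> verts G" and "v \<in> verts G" and "u \<noteq> v"
  using assms by (fastforce simp: simple_graph_def nbrs_def doubleton_eq_iff)+

lemma is_walk_Cons:
  "is_walk G (v # xs) \<longleftrightarrow> v \<in> verts G \<and> (xs = [] \<or> is_walk G xs \<and> hd xs \<in> nbrs G v)"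
proof (cases xs)
  case (Cons y ys)
  have all_nat: "(\<forall>i. P i) \<longleftrightarrow> P 0 \<and> (\<forall>i. P (Suc i))" for P
    by (metis not0_implies_Suc)
  have "(\<forall>i. Suc i < length (v # xs) \<longrightarrow> {(v # xs) ! i, (v # xs) ! Suc i} \<in> edges G) \<longleftrightarrow>
      {v, y} \<in> edges G \<and> (\<forall>i. Suc i < length xs \<longrightarrow> {xs ! i, xs ! Suc i} \<in> edges G)"
    unfolding Cons by (subst all_nat) simp
  then show ?thesis using Cons by (auto simp: is_walk_def nbrs_def)
qed (auto simp: is_walk_def)

text \<open>Walks are classified by their second vertex. Finiteness is proved along with the
  cardinality because the cardinality of the disjoint union depends on it.\<close>

lemma finite_saws_avoiding_and_card:
  assumes G: "simple_graph G" and fin: "\<And>v. finite (nbrs G v)" and v: "v \<in> verts G"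
  shows "finite {xs. is_walk G xs \<and> distinct xs \<and> hd xs = v \<and> length xs = n + 1 \<and> set xs \<inter> A = {}}
    \<and> card {xs. is_walk G xs \<and> distinct xs \<and> hd xs = v \<and> length xs = n + 1 \<and> set xs \<inter> A = {}}
      = saw_num (nbrs G) n v A"
  using v
proof (induction n arbitrary: v A)
  case 0
  have "{xs. is_walk G xs \<and> distinct xs \<and> hd xs = v \<and> length xs = 0 + 1 \<and> set xs \<inter> A = {}} =
      (if v \<in> A then {} else {[v]})"
    using 0 by (auto simp: length_Suc_conv is_walk_Cons)
  then show ?case by simp
next
  case (Suc n)
  define S where "S n v A = {xs. is_walk G xs \<and> distinct xs \<and> hd xs = v \<and> length xs = n + 1 \<and>
    set xs \<inter> A = {}}" for n v A
  have IH: "finite (S n u B) \<and> card (S n u B) = saw_num (nbrs G) n u B" if "u \<in> nbrs G v" for u B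
    using Suc.IH[of u B] simple_graph_nbrs[OF G that] unfolding S_def by blast
  have split: "S (Suc n) v A =
      (if v \<in> A then {} else (\<Union>u\<in>nbrs G v. (#) v ` S n u (insert v A)))" (is "_ = ?R")
  proof (intro equalityI subsetI)
    fix xs assume xs: "xs \<in> S (Suc n) v A"
    then obtain y ys where "xs = v # y # ys"
      by (auto simp: S_def length_Suc_conv)
    then show "xs \<in> ?R" using xs
      by (auto simp: S_def is_walk_Cons intro!: bexI[of _ y] image_eqI[of _ _ "y # ys"])
  next
    fix xs assume "xs \<in> ?R"
    then show "xs \<in> S (Suc n) v A" using Suc.prems
      by (auto simp: S_def is_walk_Cons split: if_splits)
  qed
  have "card (\<Union>u\<in>nbrs G v. (#) v ` S n u (insert v A)) =
      (\<Sum>u\<in>nbrs G v. card ((#) v ` S n u (insert v A)))"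
  proof (rule card_UN_disjoint)
    show "\<forall>u\<in>nbrs G v. finite ((#) v ` S n u (insert v A))" using IH by blast
  qed (use fin in \<open>auto simp: S_def\<close>)
  also have "\<dots> = (\<Sum>u\<in>nbrs G v. saw_num (nbrs G) n u (insert v A))"
    using IH by (intro sum.cong refl) (simp add: card_image)
  finally have "finite (S (Suc n) v A) \<and> card (S (Suc n) v A) = saw_num (nbrs G) (Suc n) v A"
    unfolding split using fin IH by auto
  then show ?case unfolding S_def .
qed

lemma saw_count_eq_saw_num:
  assumes "simple_graph G" and "\<And>v. finite (nbrs G v)" and "v \<in> verts G"
  shows "saw_count G v n = saw_num (nbrs G) n v {}"
  using finite_saws_avoiding_and_card[OF assms, of n "{}"] by (simp add: saw_count_def saws_def)

lemma card_nbrs: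
  assumes "simple_graph G"
  shows "card (nbrs G v) = vdegree G v"
proof -
  have "bij_betw (\<lambda>u. {v, u}) (nbrs G v) {e \<in> edges G. v \<in> e}"
  proof (rule bij_betwI')
    fix e assume e: "e \<in> {e \<in> edges G. v \<in> e}"
    then obtain a b where "e = {a, b}" using assms by (auto simp: simple_graph_def)
    then show "\<exists>u\<in>nbrs G v. e = {v, u}"
      using e by (auto simp: nbrs_def insert_commute)
  qed (auto simp: nbrs_def doubleton_eq_iff)
  then show ?thesis by (simp add: vdegree_def bij_betw_same_card)
qed

lemma walk_rtrancl:
  "is_walk G xs \<Longrightarrow> (hd xs, last xs) \<in> {(a, b). b \<in> nbrs G a}\<^sup>*"
proof (induction xs)
  case (Cons v xs)
  then show ?case
    by (auto simp: is_walk_Cons intro: converse_rtrancl_into_rtrancl)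
qed (simp add: is_walk_def)

lemma automorphism_nbrs:
  assumes "simple_graph G" and "automorphism f G" and "v \<in> verts G"
  shows "nbrs G (f v) = f ` nbrs G v"
proof (intro equalityI subsetI)
  fix w assume w: "w \<in> nbrs G (f v)"
  then have "w \<in> f ` verts G"
    using simple_graph_nbrs[OF assms(1) w] assms(2)
    by (simp add: automorphism_def graph_iso_def bij_betw_def)
  then show "w \<in> f ` nbrs G v"
    using w assms(2,3) by (auto simp: automorphism_def graph_iso_def nbrs_def)
next
  fix w assume "w \<in> f ` nbrs G v"
  then obtain u where u: "u \<in> nbrs G v" "w = f u" by blast
  then show "w \<in> nbrs G (f v)"
    using simple_graph_nbrs[OF assms(1) u(1)] assms(2,3)
    by (auto simp: automorphism_def graph_iso_def nbrs_def)
qed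

lemma cubic_system_nbrs:
  assumes "simple_graph G" and "infinite_graph G" and "connected_graph G"
    and "cubic_graph G" and "quasi_transitive G"
  shows "cubic_system (verts G) (nbrs G)"
proof
  show "finite (nbrs G v)" for v
  proof (cases "v \<in> verts G")
    case True
    then have "card (nbrs G v) = 3" using assms(4) card_nbrs[OF assms(1)] by (simp add: cubic_graph_def)
    then show ?thesis by (intro card_ge_0_finite) simp
  next
    case False
    then have "nbrs G v = {}" using simple_graph_nbrs[OF assms(1)] by blast
    then show ?thesis by simp
  qed
  show "card (nbrs G v) = 3" if "v \<in> verts G" for v
    using that assms(4) card_nbrs[OF assms(1)] by (simp add: cubic_graph_def)
  show "(u, v) \<in> {(a, b). b \<in> nbrs G a}\<^sup>*" if "u \<in> verts G" "v \<in> verts G" for u v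
  proof -
    obtain xs where "is_walk G xs" "hd xs = u" "last xs = v"
      using assms(3) \<open>u \<in> verts G\<close> \<open>v \<in> verts G\<close> unfolding connected_graph_def by blast
    then show ?thesis using walk_rtrancl by blast
  qed
  obtain W where W: "W \<subseteq> verts G" "finite W" "\<forall>v\<in>verts G. \<exists>f. automorphism f G \<and> f v \<in> W"
    using assms(5) unfolding quasi_transitive_def by blast
  have "inj_on f (verts G) \<and> (\<forall>u\<in>verts G. f u \<in> verts G \<and> nbrs G (f u) = f ` nbrs G u)"
    if "automorphism f G" for f
    using that automorphism_nbrs[OF assms(1) that]
    by (auto simp: automorphism_def graph_iso_def bij_betw_def)
  then show "\<exists>W. finite W \<and> W \<subseteq> verts G \<and> (\<forall>v\<in>verts G. \<exists>f. inj_on f (verts G) \<and>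
      (\<forall>u\<in>verts G. f u \<in> verts G \<and> nbrs G (f u) = f ` nbrs G u) \<and> f v \<in> W)"
    using W by (intro exI[of _ W]) metis
qed (use simple_graph_nbrs[OF assms(1)] assms(2) in \<open>auto simp: nbrs_sym infinite_graph_def\<close>)

section \<open>Passage to the relabelled copy\<close>

lemma nbrs_relabel:
  assumes "inj f"
  shows "nbrs (relabel f G) (f v) = f ` nbrs G v"
proof -
  have edge: "{f v, f u} \<in> edges (relabel f G) \<longleftrightarrow> {v, u} \<in> edges G" for u
    using inj_image_mem_iff[of "(`) f" "{v, u}" "edges G"] assms
    by (simp add: relabel_def inj_image_eq_iff inj_def)
  have "u \<in> range f" if "{f v, u} \<in> edges (relabel f G)" for u
    using that by (auto simp: relabel_def)
  then show ?thesis using edge by (fastforce simp: nbrs_def)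
qed

lemma simple_graph_relabel:
  assumes "inj f" and "simple_graph G"
  shows "simple_graph (relabel f G)"
  unfolding simple_graph_def
proof
  fix e assume "e \<in> edges (relabel f G)"
  then obtain e' where e': "e' \<in> edges G" "e = f ` e'" by (auto simp: relabel_def)
  then obtain u v where "u \<in> verts G" "v \<in> verts G" "u \<noteq> v" "e' = {u, v}"
    using assms(2) unfolding simple_graph_def by blast
  then show "\<exists>u\<in>verts (relabel f G). \<exists>v\<in>verts (relabel f G). u \<noteq> v \<and> e = {u, v}"
    using e' assms(1) by (intro bexI[of _ "f u"] bexI[of _ "f v"]) (auto simp: relabel_def inj_eq)
qed

lemma cubic_system_relabel:
  assumes "inj f" and "simple_graph G" and "cubic_system (verts G) (nbrs G)"
  shows "cubic_system (verts (relabel f G)) (nbrs (relabel f G))"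
proof -
  interpret cubic_system "verts G" "nbrs G" by fact
  have V: "verts (relabel f G) = f ` verts G" by (simp add: relabel_def)
  note N = nbrs_relabel[OF assms(1), of G]
  note simple = simple_graph_nbrs[OF simple_graph_relabel[OF assms(1,2)]]
  have step: "(f u, f v) \<in> {(a, b). b \<in> nbrs (relabel f G) a}\<^sup>*"
    if "(u, v) \<in> {(a, b). b \<in> nbrs G a}\<^sup>*" for u v
    using that
  proof (induction rule: rtrancl_induct)
    case (step y z)
    then have "(f y, f z) \<in> {(a, b). b \<in> nbrs (relabel f G) a}" by (simp add: N)
    with step.IH show ?case by (rule rtrancl_into_rtrancl)
  qed simp
  obtain W where W: "finite W" "W \<subseteq> verts G" "\<forall>v\<in>verts G. \<exists>h. inj_on h (verts G) \<and>
      (\<forall>u\<in>verts G. h u \<in> verts G \<and> nbrs G (h u) = h ` nbrs G u) \<and> h v \<in> W"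
    using finitely_many_orbits by blast
  have orbit: "\<exists>h. inj_on h (f ` verts G) \<and> (\<forall>u\<in>f ` verts G. h u \<in> f ` verts G \<and>
      nbrs (relabel f G) (h u) = h ` nbrs (relabel f G) u) \<and> h (f v) \<in> f ` W"
    if v: "v \<in> verts G" for v
  proof -
    obtain h where h: "inj_on h (verts G)" "\<forall>u\<in>verts G. h u \<in> verts G \<and> nbrs G (h u) = h ` nbrs G u"
      "h v \<in> W" using W(3) v by blast
    \<comment> \<open>The symmetry \<open>h\<close> is conjugated by the relabelling.\<close>
    have "inj_on (\<lambda>w. f (h (inv f w))) (f ` verts G)"
      using h(1) assms(1) by (auto simp: inj_on_def)
    then show ?thesis
      using h assms(1) by (intro exI[of _ "\<lambda>w. f (h (inv f w))"]) (auto simp: N image_image)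
  qed
  show ?thesis
  proof
    show "finite (nbrs (relabel f G) v)" for v
    proof (cases "v \<in> f ` verts G")
      case True
      then show ?thesis using finite_N by (auto simp: N)
    next
      case False
      then have "nbrs (relabel f G) v = {}" using simple V by blast
      then show ?thesis by simp
    qed
    show "card (nbrs (relabel f G) v) = 3" if "v \<in> verts (relabel f G)" for v
      using that card_N inj_on_subset[OF assms(1)] by (auto simp: V N card_image)
    show "infinite (verts (relabel f G))"
      using infinite_V inj_on_subset[OF assms(1)] by (auto simp: V finite_image_iff)
    show "\<exists>W. finite W \<and> W \<subseteq> verts (relabel f G) \<and> (\<forall>v\<in>verts (relabel f G). \<exists>h.
        inj_on h (verts (relabel f G)) \<and> (\<forall>u\<in>verts (relabel f G). h u \<in> verts (relabel f G) \<and>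
        nbrs (relabel f G) (h u) = h ` nbrs (relabel f G) u) \<and> h v \<in> W)"
      unfolding V using W orbit by (intro exI[of _ "f ` W"]) blast
  qed (use simple connected step in \<open>auto simp: nbrs_sym V\<close>)
qed

section \<open>The Fisher transformation\<close>

lemma nbrs_fisher_Corner:
  assumes "simple_graph H"
  shows "nbrs (fisher H) (Corner v u) =
    (if u \<in> nbrs H v then insert (Corner u v) (Corner v ` (nbrs H v - {u})) else {})"
proof -
  define T where "T = {{Corner v u, Corner v w} | v u w.
    {v, u} \<in> edges H \<and> {v, w} \<in> edges H \<and> u \<noteq> w}"
  define X where "X = {{Corner v u, Corner u v} | v u. {v, u} \<in> edges H}"
  have E: "edges (fisher H) = T \<union> X" by (simp add: fisher_def T_def X_def)
  have T: "{Corner v u, x} \<in> T \<longleftrightarrow> u \<in> nbrs H v \<and> (\<exists>w\<in>nbrs H v. w \<noteq> u \<and> x = Corner v w)" for x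
    by (auto simp: T_def doubleton_eq_iff nbrs_def)
  have X: "{Corner v u, x} \<in> X \<longleftrightarrow> u \<in> nbrs H v \<and> x = Corner u v" for x
  proof -
    \<comment> \<open>An unordered pair can be matched from either end, hence the disjunction;
      symmetry of adjacency then removes it.\<close>
    have "{Corner v u, x} \<in> X \<longleftrightarrow> (u \<in> nbrs H v \<or> v \<in> nbrs H u) \<and> x = Corner u v"
      by (auto simp: X_def doubleton_eq_iff nbrs_def)
    then show ?thesis using nbrs_sym[of v H u] by blast
  qed
  have "x \<in> nbrs (fisher H) (Corner v u) \<longleftrightarrow>
      u \<in> nbrs H v \<and> (x = Corner u v \<or> (\<exists>w\<in>nbrs H v. w \<noteq> u \<and> x = Corner v w))" for x
    unfolding nbrs_def[of "fisher H"] mem_Collect_eq E Un_iff T X by blast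
  then show ?thesis by auto
qed

lemma nbrs_fisher_Orig: "nbrs (fisher H) (Orig a) = {}"
  by (auto simp: nbrs_def fisher_def doubleton_eq_iff)

lemma verts_fisher: "verts (fisher H) = {Corner v u | v u. u \<in> nbrs H v}"
  by (simp add: fisher_def nbrs_def)

lemma simple_graph_fisher:
  assumes "simple_graph H"
  shows "simple_graph (fisher H)"
  unfolding simple_graph_def
proof
  have ne: "u \<noteq> v" if "{v, u} \<in> edges H" for u v
    using simple_graph_nbrs(3)[OF assms, of u v] that by (simp add: nbrs_def)
  fix e assume "e \<in> edges (fisher H)"
  then consider v u w where "e = {Corner v u, Corner v w}" "{v, u} \<in> edges H" "{v, w} \<in> edges H" "u \<noteq> w"
    | v u where "e = {Corner v u, Corner u v}" "{v, u} \<in> edges H"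
    by (auto simp: fisher_def)
  then show "\<exists>u\<in>verts (fisher H). \<exists>v\<in>verts (fisher H). u \<noteq> v \<and> e = {u, v}"
  proof cases
    case (1 v u w)
    then show ?thesis
      by (intro bexI[of _ "Corner v u"] bexI[of _ "Corner v w"]) (auto simp: fisher_def)
  next
    case (2 v u)
    then have "{u, v} \<in> edges H" by (simp add: insert_commute)
    with 2 show ?thesis using ne
      by (intro bexI[of _ "Corner v u"] bexI[of _ "Corner u v"]) (auto simp: fisher_def)
  qed
qed

section \<open>The Fisher graph is again a cubic system\<close>

locale cubic_fvert_graph =
  fixes H :: "'a fvert ugraph"
  assumes simple: "simple_graph H" and system: "cubic_system (verts H) (nbrs H)"
begin

abbreviation "N \<equiv> nbrs H"
abbreviation "N' \<equiv> nbrs (fisher H)"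

sublocale cubic_system "verts H" N by (rule system)

lemmas N'_Corner = nbrs_fisher_Corner[OF simple]

lemma nbrs_three:
  assumes "v \<in> N w"
  obtains c d where "N w = {v, c, d}" "v \<noteq> c" "v \<noteq> d" "c \<noteq> d"
proof -
  have "card (N w) = 3" using card_N simple_graph_nbrs[OF simple assms] by blast
  then have "card (N w - {v}) = 2" using assms finite_N by simp
  then obtain c d where "N w - {v} = {c, d}" "c \<noteq> d" by (auto simp: card_2_iff)
  then show ?thesis using that[of c d] assms by blast
qed

lemma sum_N':
  fixes h :: "'a fvert \<Rightarrow> real"
  assumes "N w = {a, b, c}" "a \<noteq> b" "a \<noteq> c" "b \<noteq> c"
  shows "(\<Sum>u\<in>N' (Corner w a). h u) = h (Corner a w) + h (Corner w b) + h (Corner w c)"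
proof -
  have "w \<noteq> a" using irrefl[of w] assms(1) by auto
  moreover have "{a, b, c} - {a} = {b, c}" using assms by auto
  ultimately show ?thesis using assms by (simp add: N'_Corner add.assoc)
qed

text \<open>Each edge of a walk in \<open>H\<close> lifts to a crossing followed by a move inside
  the new triangle. The final corner stays arbitrary in the induction, so the hypothesis can be used
  at the corner facing the next vertex.\<close>

lemma fisher_connected:
  assumes "(v, w) \<in> {(a, b). b \<in> N a}\<^sup>*" and "u \<in> N v" and "x \<in> N w"
  shows "(Corner v u, Corner w x) \<in> {(a, b). b \<in> N' a}\<^sup>*"
proof -
  have triangle: "(Corner y p, Corner y q) \<in> {(a, b). b \<in> N' a}\<^sup>*" if "p \<in> N y" "q \<in> N y" for y p q
    using that by (cases "p = q") (auto simp: N'_Corner)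
  show ?thesis
    using assms(1,3)
  proof (induction arbitrary: x rule: rtrancl_induct)
    case base
    then show ?case using triangle assms(2) by blast
  next
    case (step y z)
    then have yz: "z \<in> N y" "y \<in> N z" using sym by auto
    have "(Corner v u, Corner y z) \<in> {(a, b). b \<in> N' a}\<^sup>*" using step.IH yz by blast
    also have "(Corner y z, Corner z y) \<in> {(a, b). b \<in> N' a}\<^sup>*" using yz by (auto simp: N'_Corner)
    also have "(Corner z y, Corner z x) \<in> {(a, b). b \<in> N' a}\<^sup>*" using triangle yz step.prems by blast
    finally show ?case .
  qed
qed

text \<open>A symmetry \<open>f\<close> of \<open>H\<close> acts on corners through both components;
  the corners at the finitely many representatives represent all orbits.\<close>

lemma fisher_orbits:
  "\<exists>W. finite W \<and> W \<subseteq> verts (fisher H) \<and> (\<forall>v\<in>verts (fisher H). \<exists>f. inj_on f (verts (fisher H)) \<and>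
    (\<forall>u\<in>verts (fisher H). f u \<in> verts (fisher H) \<and> N' (f u) = f ` N' u) \<and> f v \<in> W)"
proof -
  obtain W where W: "finite W" "W \<subseteq> verts H" "\<forall>v\<in>verts H. \<exists>f. inj_on f (verts H) \<and>
      (\<forall>u\<in>verts H. f u \<in> verts H \<and> N (f u) = f ` N u) \<and> f v \<in> W"
    using finitely_many_orbits by blast
  define W' where "W' = (\<Union>w\<in>W. Corner w ` N w)"
  have "\<exists>f. inj_on f (verts (fisher H)) \<and>
    (\<forall>c\<in>verts (fisher H). f c \<in> verts (fisher H) \<and> N' (f c) = f ` N' c) \<and> f (Corner v u) \<in> W'"
    if vu: "u \<in> N v" for v u
  proof -
    note simple_N = simple_graph_nbrs[OF simple]
    obtain f where f: "inj_on f (verts H)" "\<forall>u\<in>verts H. f u \<in> verts H \<and> N (f u) = f ` N u" "f v \<in> W"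
      using W(3) simple_N[OF vu] by blast
    have fN: "N (f a) = f ` N a" if "b \<in> N a" for a b using f(2) simple_N[OF that] by blast
    have diff: "f ` N a - {f b} = f ` (N a - {b})" if "b \<in> N a" for a b
      using inj_on_image_set_diff[OF f(1), of "N a" "{b}"] closed simple_N[OF that] that by auto
    \<comment> \<open>The value on \<open>Orig\<close> is a default, since all vertices of
      \<open>fisher H\<close> are corners.\<close>
    define h where "h = (\<lambda>c. case c of Orig a \<Rightarrow> Orig a | Corner a b \<Rightarrow> Corner (f a) (f b))"
    have h: "h (Corner a b) = Corner (f a) (f b)" for a b by (simp add: h_def)
    have "inj_on h (verts (fisher H))"
    proof (rule inj_onI)
      fix c c' assume c: "c \<in> verts (fisher H)" "c' \<in> verts (fisher H)" "h c = h c'"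
      then obtain a b a' b' where ab: "c = Corner a b" "c' = Corner a' b'" "b \<in> N a" "b' \<in> N a'"
        by (auto simp: verts_fisher)
      then have "f a = f a'" "f b = f b'" using c(3) by (auto simp: h)
      then show "c = c'" using ab simple_N[OF ab(3)] simple_N[OF ab(4)] f(1) by (auto dest: inj_onD)
    qed
    moreover have "h c \<in> verts (fisher H) \<and> N' (h c) = h ` N' c" if cV: "c \<in> verts (fisher H)" for c
    proof -
      obtain a b where ab: "c = Corner a b" "b \<in> N a" using cV by (auto simp: verts_fisher)
      have "N' (h c) = insert (Corner (f b) (f a)) (Corner (f a) ` f ` (N a - {b}))"
        using ab fN[OF ab(2)] diff[OF ab(2)] by (simp add: h N'_Corner)
      also have "\<dots> = h ` N' c" using ab by (simp add: h N'_Corner image_image)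
      finally show ?thesis using ab fN[OF ab(2)] by (auto simp: h verts_fisher)
    qed
    moreover have "h (Corner v u) \<in> W'" using f(3) fN[OF vu] vu by (auto simp: h W'_def)
    ultimately show ?thesis by blast
  qed
  moreover have "finite W'" using W finite_N by (auto simp: W'_def)
  moreover have "W' \<subseteq> verts (fisher H)" by (auto simp: W'_def verts_fisher)
  ultimately show ?thesis by (intro exI[of _ W']) (auto simp: verts_fisher)
qed

lemma cubic_system_fisher: "cubic_system (verts (fisher H)) N'"
proof
  note simple_N' = simple_graph_nbrs[OF simple_graph_fisher[OF simple]]
  show "N' c \<subseteq> verts (fisher H)" for c using simple_N' by blast
  show "finite (N' c)" for c
    by (cases c) (simp_all add: nbrs_fisher_Orig N'_Corner finite_N)
  show "card (N' c) = 3" if c: "c \<in> verts (fisher H)" for c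
  proof -
    obtain v u where vu: "c = Corner v u" "u \<in> N v" using c by (auto simp: verts_fisher)
    have "u \<noteq> v" "v \<in> verts H" using simple_graph_nbrs[OF simple vu(2)] by auto
    then have "card (N' c) = Suc (card (Corner v ` (N v - {u})))"
      using vu finite_N by (simp add: N'_Corner card_insert_if image_iff)
    also have "\<dots> = 3" using vu card_N[OF \<open>v \<in> verts H\<close>] finite_N by (simp add: card_image inj_on_def)
    finally show ?thesis .
  qed
  show "infinite (verts (fisher H))"
  proof
    \<comment> \<open>Sends a corner to the vertex whose triangle it belongs to, so its image covers
      the infinite set \<open>verts H\<close>.\<close>
    define base where "base = (\<lambda>c :: 'a fvert. case c of Orig a \<Rightarrow> c | Corner v u \<Rightarrow> v)"
    assume "finite (verts (fisher H))"
    then have "finite (base ` verts (fisher H))" by simp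
    moreover have "verts H \<subseteq> base ` verts (fisher H)"
    proof
      fix v assume "v \<in> verts H"
      then have "N v \<noteq> {}" using card_N by fastforce
      then obtain u where "u \<in> N v" by blast
      then have "Corner v u \<in> verts (fisher H)" by (simp add: verts_fisher)
      then show "v \<in> base ` verts (fisher H)"
        by (intro image_eqI[of _ _ "Corner v u"]) (auto simp: base_def)
    qed
    ultimately show False using infinite_V finite_subset by blast
  qed
  show "(a, b) \<in> {(a, b). b \<in> N' a}\<^sup>*"
    if ab: "a \<in> verts (fisher H)" "b \<in> verts (fisher H)" for a b
  proof -
    obtain v u w x where "a = Corner v u" "b = Corner w x" "u \<in> N v" "x \<in> N w"
      using ab by (auto simp: verts_fisher)
    then show ?thesis using fisher_connected connected simple_graph_nbrs[OF simple] by blast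
  qed
qed (use fisher_orbits simple_graph_nbrs[OF simple_graph_fisher[OF simple]] in \<open>auto simp: nbrs_sym\<close>)

section \<open>Comparison of the generating functions of \<open>H\<close> and
  \<open>fisher H\<close>\<close>

text \<open>Here \<open>A\<close> is the set of triangles already traversed and \<open>B\<close> the set of corners already
  visited. A traversal uses at least two of the three corners, so a walk that re-enters a triangle
  of \<open>A\<close> is stuck at once. A fresh triangle is crossed, with the edge leaving it, in 2 or 3 steps,
  whence the argument \<open>x\<^sup>2 + x\<^sup>3\<close>.\<close>

lemma fisher_gf_upper:
  fixes x :: real
  defines "K \<equiv> 1 + 2 * x + 2 * x ^ 2 + 2 * (x ^ 2 + x ^ 3)"
  assumes x: "0 \<le> x"
    and "v \<in> N w" and "w \<notin> A" and "Corner v w \<in> B"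
    and "\<And>a e f. a \<in> A \<Longrightarrow> e \<in> N a \<Longrightarrow> f \<in> N a \<Longrightarrow> e \<noteq> f \<Longrightarrow> Corner a e \<in> B \<or> Corner a f \<in> B"
  shows "saw_gf N' x M (Corner w v) B \<le> K * saw_gf N (x ^ 2 + x ^ 3) M w A"
  using assms(3-)
proof (induction M arbitrary: v w A B)
  case 0
  have "1 \<le> K" unfolding K_def using x by simp
  then show ?case using 0 by (simp add: saw_gf_0)
next
  case (Suc M)
  define g where "g = x ^ 2 + x ^ 3"
  define B1 where "B1 = insert (Corner w v) B"
  define z where "z e = saw_gf N g M e (insert w A)" for e
  have K0: "0 \<le> K" and g0: "0 \<le> g" unfolding K_def g_def using x by simp_all
  have z0: "0 \<le> z e" for e unfolding z_def by (rule saw_gf_nonneg[OF g0])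
  obtain c d where cd: "N w = {v, c, d}" "v \<noteq> c" "v \<noteq> d" "c \<noteq> d"
    using nbrs_three[OF Suc.prems(1)] by blast
  \<comment> \<open>The summand 1 pays for a walk that is stuck in an old triangle,
    \<open>K * z e\<close> for one that enters a fresh triangle.\<close>
  have enter: "saw_gf N' x M (Corner e w) B' \<le> 1 + K * z e"
    if e: "e \<in> N w" "e \<noteq> v" and B': "B1 \<subseteq> B'" "Corner w e \<in> B'" for e B'
  proof (cases "e \<in> A")
    case True
    have "w \<in> N e" using e sym by blast
    then obtain p q where pq: "N e = {w, p, q}" "w \<noteq> p" "w \<noteq> q" "p \<noteq> q" using nbrs_three by blast
    have "saw_gf N' x M (Corner e w) B' \<le> 1"
    proof (cases "Corner e w \<in> B'")
      case False
      then have "Corner e w \<notin> B" using B' by (auto simp: B1_def)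
      \<comment> \<open>The arrival corner is unvisited, so the invariant, applied to it and each of
        the other two corners, shows that both of those are visited.\<close>
      then have "Corner e p \<in> B'" "Corner e q \<in> B'"
        using Suc.prems(4)[OF True, of w] pq B' by (auto simp: B1_def)
      then show ?thesis
        using saw_gf_le_step[OF x, of N' M "Corner e w" B'] sum_N'[OF pq] B' by simp
    qed simp
    then show ?thesis using K0 z0[of e] by (smt (verit) mult_nonneg_nonneg)
  next
    case False
    have "saw_gf N' x M (Corner e w) B' \<le> K * saw_gf N (x ^ 2 + x ^ 3) M e (insert w A)"
    proof (rule Suc.IH)
      show "w \<in> N e" using e sym by blast
      show "e \<notin> insert w A" using False e irrefl by blast
      show "Corner w e \<in> B'" by (rule B')
      show "Corner a p \<in> B' \<or> Corner a q \<in> B'"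
        if a: "a \<in> insert w A" "p \<in> N a" "q \<in> N a" "p \<noteq> q" for a p q
      proof (cases "a = w")
        case True
        have "Corner w v \<in> B'" using B' by (auto simp: B1_def)
        \<comment> \<open>Pigeonhole: two distinct elements of a three-element set cannot both miss
          \<open>{v, e}\<close>.\<close>
        moreover have "p \<in> {v, e} \<or> q \<in> {v, e}" using a True cd e by auto
        ultimately show ?thesis using True B' by auto
      next
        case False
        then have "Corner a p \<in> B \<or> Corner a q \<in> B" using Suc.prems(4) a by blast
        then show ?thesis using B' by (auto simp: B1_def)
      qed
    qed
    then show ?thesis by (simp add: z_def g_def)
  qed
  \<comment> \<open>From \<open>Corner w c\<close> the walk leaves at once or moves on to
    \<open>Corner w d\<close> and leaves there. With the step from \<open>Corner w v\<close>, the
    two exits weigh \<open>x ^ 2\<close> and \<open>x ^ 3\<close>.\<close>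
  have cross: "saw_gf N' x M (Corner w c) B1 \<le> 1 + x * (1 + K * z c) + x * (1 + x * (1 + K * z d))"
    if cd: "N w = {v, c, d}" "v \<noteq> c" "v \<noteq> d" "c \<noteq> d" for c d
  proof -
    define B2 where "B2 = insert (Corner w c) B1"
    define B3 where "B3 = insert (Corner w d) B2"
    have in_B: "Corner w v \<in> B1" "Corner w c \<in> B2" "Corner w v \<in> B2" "Corner w d \<in> B3"
      "Corner w v \<in> B3" "Corner w c \<in> B3" "B1 \<subseteq> B2" "B1 \<subseteq> B3"
      by (auto simp: B1_def B2_def B3_def)
    have Nc: "N w = {c, v, d}" and Nd: "N w = {d, v, c}" using cd by auto
    have "saw_gf N' x M (Corner w d) B2 \<le> 1 + x * saw_gf N' x M (Corner d w) B3"
      using saw_gf_le_step[OF x, of N' M "Corner w d" B2] sum_N'[OF Nd] cd in_B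
      by (simp flip: B3_def)
    also have "\<dots> \<le> 1 + x * (1 + K * z d)"
      using x cd in_B by (intro add_left_mono mult_left_mono enter) auto
    finally have d: "saw_gf N' x M (Corner w d) B2 \<le> 1 + x * (1 + K * z d)" .
    have "saw_gf N' x M (Corner w c) B1 \<le>
        1 + x * (saw_gf N' x M (Corner c w) B2 + saw_gf N' x M (Corner w d) B2)"
      using saw_gf_le_step[OF x, of N' M "Corner w c" B1] sum_N'[OF Nc] cd in_B
      by (simp flip: B2_def)
    also have "\<dots> \<le> 1 + x * ((1 + K * z c) + (1 + x * (1 + K * z d)))"
      using x cd in_B by (intro add_left_mono mult_left_mono add_mono enter d) auto
    finally show ?thesis by (simp add: algebra_simps)
  qed
  have "saw_gf N' x (Suc M) (Corner w v) B \<le>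
      1 + x * (saw_gf N' x M (Corner w c) B1 + saw_gf N' x M (Corner w d) B1)"
  proof -
    have "0 \<le> x * (saw_gf N' x M (Corner w c) B1 + saw_gf N' x M (Corner w d) B1)"
      using x by (intro mult_nonneg_nonneg add_nonneg_nonneg saw_gf_nonneg)
    then show ?thesis
      using sum_N'[OF cd, of "\<lambda>u. saw_gf N' x M u B1"] Suc.prems(3)
      by (simp add: saw_gf_Suc flip: B1_def) (simp add: B1_def)
  qed
  also have "\<dots> \<le> 1 + x * ((1 + x * (1 + K * z c) + x * (1 + x * (1 + K * z d))) +
      (1 + x * (1 + K * z d) + x * (1 + x * (1 + K * z c))))"
    using x cd by (intro add_left_mono mult_left_mono add_mono cross) auto
  also have "\<dots> = 1 + 2 * x + 2 * x ^ 2 + g * (2 + K * (z c + z d))"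
    by (simp add: g_def algebra_simps power2_eq_square power3_eq_cube)
  \<comment> \<open>\<open>K\<close> is chosen as exactly the constant term here: walks ending
    inside the triangle, and the two allowances of 1 from \<open>enter\<close>.\<close>
  also have "\<dots> = K * (1 + g * (z c + z d))"
    by (simp add: K_def g_def algebra_simps)
  \<comment> \<open>The walk in \<open>fisher H\<close> cannot go back across the edge to
    \<open>v\<close>, but the recursion in \<open>H\<close> may count \<open>v\<close>; adding
    \<open>z v\<close> only enlarges the bound.\<close>
  also have "\<dots> \<le> K * (1 + g * (z v + z c + z d))"
    using K0 g0 z0[of v] by (intro mult_left_mono add_left_mono) auto
  also have "\<dots> = K * saw_gf N g (Suc M) w A"
    using cd Suc.prems(2) by (simp add: saw_gf_Suc z_def add.assoc)
  finally show ?case unfolding g_def .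
qed

text \<open>Walks of \<open>H\<close> lift: the triangles outside \<open>A\<close> are untouched, so
  every step can be realised by the short or the long passage. Each costs at most 3 steps, hence the
  truncation \<open>3 * M\<close>.\<close>

lemma fisher_gf_lower:
  fixes x :: real
  assumes x: "0 \<le> x" and "v \<in> N w" and "v \<in> A"
    and "\<And>a e. a \<notin> A \<Longrightarrow> Corner a e \<notin> B"
  shows "saw_gf N (x ^ 2 + x ^ 3) M w A \<le> saw_gf N' x (3 * M) (Corner w v) B"
  using assms(2-)
proof (induction M arbitrary: v w A B)
  case 0
  then show ?case by (simp add: saw_gf_0)
next
  case (Suc M)
  define g where "g = x ^ 2 + x ^ 3"
  define B1 where "B1 = insert (Corner w v) B"
  define z where "z e = saw_gf N g M e (insert w A)" for e
  show ?case
  proof (cases "w \<in> A")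
    case True
    then show ?thesis using saw_gf_nonneg[OF x] by simp
  next
    case False
    have step: "x * (saw_gf N' x n (Corner b w) (insert (Corner w b) C) +
        saw_gf N' x n (Corner w c) (insert (Corner w b) C) +
        saw_gf N' x n (Corner w d) (insert (Corner w b) C)) \<le> saw_gf N' x (Suc n) (Corner w b) C"
      if "N w = {b, c, d}" "b \<noteq> c" "b \<noteq> d" "c \<noteq> d" "Corner w b \<notin> C" for b c d n C
      using sum_N'[OF that(1-4), of "\<lambda>u. saw_gf N' x n u (insert (Corner w b) C)"] that(5)
      by (simp add: saw_gf_Suc)
    obtain c d where cd: "N w = {v, c, d}" "v \<noteq> c" "v \<noteq> d" "c \<noteq> d"
      using nbrs_three[OF Suc.prems(1)] by blast
    have B: "Corner w e \<notin> B" for e using Suc.prems(3) False by blast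
    \<comment> \<open>Larger truncations \<open>n\<close> are allowed because the short exit has one
      step more to spare than the long one.\<close>
    have enter: "z e \<le> saw_gf N' x n (Corner e w) C"
      if e: "e \<in> N w" "3 * M \<le> n" and C: "\<And>a f. a \<notin> insert w A \<Longrightarrow> Corner a f \<notin> C" for e n C
    proof -
      have "z e \<le> saw_gf N' x (3 * M) (Corner e w) C"
        unfolding z_def g_def using e sym C by (intro Suc.IH) auto
      also have "\<dots> \<le> saw_gf N' x n (Corner e w) C" by (rule saw_gf_mono[OF x e(2)])
      finally show ?thesis .
    qed
    have cross: "x * z c + x * (x * z d) \<le> saw_gf N' x (3 * M + 2) (Corner w c) B1"
      if cd: "N w = {v, c, d}" "v \<noteq> c" "v \<noteq> d" "c \<noteq> d" for c d
    proof -
      define B2 where "B2 = insert (Corner w c) B1"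
      define B3 where "B3 = insert (Corner w d) B2"
      have Nc: "N w = {c, v, d}" and Nd: "N w = {d, v, c}" using cd by auto
      have C: "Corner a f \<notin> B2" "Corner a f \<notin> B3" if "a \<notin> insert w A" for a f
        using that Suc.prems(3) by (auto simp: B1_def B2_def B3_def)
      have "x * z d \<le> x * (saw_gf N' x (3 * M) (Corner d w) B3 +
          saw_gf N' x (3 * M) (Corner w v) B3 + saw_gf N' x (3 * M) (Corner w c) B3)"
        using x cd C by (intro mult_left_mono) (auto intro!: add_increasing2 saw_gf_nonneg enter)
      also have "\<dots> \<le> saw_gf N' x (Suc (3 * M)) (Corner w d) B2"
        using step[OF Nd, of B2 "3 * M"] cd B by (auto simp: B3_def B2_def B1_def)
      finally have d: "x * z d \<le> saw_gf N' x (Suc (3 * M)) (Corner w d) B2" .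
      have "x * (z c + x * z d) \<le> x * (saw_gf N' x (Suc (3 * M)) (Corner c w) B2 +
          saw_gf N' x (Suc (3 * M)) (Corner w v) B2 + saw_gf N' x (Suc (3 * M)) (Corner w d) B2)"
      proof (intro mult_left_mono add_mono d x)
        have "z c \<le> saw_gf N' x (Suc (3 * M)) (Corner c w) B2" using cd C by (intro enter) auto
        then show "z c \<le> saw_gf N' x (Suc (3 * M)) (Corner c w) B2 +
            saw_gf N' x (Suc (3 * M)) (Corner w v) B2"
          using saw_gf_nonneg[OF x, of N' "Suc (3 * M)" "Corner w v" B2] by linarith
      qed
      also have "\<dots> \<le> saw_gf N' x (Suc (Suc (3 * M))) (Corner w c) B1"
        using step[OF Nc, of B1 "Suc (3 * M)"] cd B by (auto simp: B2_def B1_def)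
      finally show ?thesis by (simp add: algebra_simps)
    qed
    \<comment> \<open>Since \<open>v\<close> is in \<open>A\<close>, the walk of \<open>H\<close>
      cannot step back, and only the two exits remain.\<close>
    have "z v = 0" using Suc.prems(2) by (simp add: z_def)
    then have "saw_gf N g (Suc M) w A = 1 + g * (z c + z d)"
      using False cd by (simp add: saw_gf_Suc z_def)
    also have "\<dots> = 1 + x * ((x * z c + x * (x * z d)) + (x * z d + x * (x * z c)))"
      by (simp add: g_def algebra_simps power2_eq_square power3_eq_cube)
    also have "\<dots> \<le> 1 + x * (saw_gf N' x (3 * M + 2) (Corner v w) B1 +
        saw_gf N' x (3 * M + 2) (Corner w c) B1 + saw_gf N' x (3 * M + 2) (Corner w d) B1)"
    proof (intro add_left_mono mult_left_mono x)
      have "x * z d + x * (x * z c) \<le> saw_gf N' x (3 * M + 2) (Corner w d) B1"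
        using cd by (intro cross) auto
      then show "(x * z c + x * (x * z d)) + (x * z d + x * (x * z c)) \<le>
          saw_gf N' x (3 * M + 2) (Corner v w) B1 + saw_gf N' x (3 * M + 2) (Corner w c) B1 +
          saw_gf N' x (3 * M + 2) (Corner w d) B1"
        using cross[OF cd] saw_gf_nonneg[OF x, of N' "3 * M + 2" "Corner v w" B1] by linarith
    qed
    also have "\<dots> = saw_gf N' x (Suc (3 * M + 2)) (Corner w v) B"
      using sum_N'[OF cd, of "\<lambda>u. saw_gf N' x (3 * M + 2) u B1"] B[of v]
      by (subst saw_gf_Suc) (simp flip: B1_def)
    also have "Suc (3 * M + 2) = 3 * Suc M" by simp
    finally show ?thesis unfolding g_def .
  qed
qed

end

section \<open>Boundedness of the generating function and the growth rate\<close>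

lemma saw_gf_bounded_if_subcritical:
  assumes lim: "(\<lambda>n. root n (real (saw_num N n v {}))) \<longlonglongrightarrow> \<mu>"
    and "0 \<le> \<mu>" and "0 < x" and "x * \<mu> < 1"
  shows "\<exists>C. \<forall>M. saw_gf N x M v {} \<le> C"
proof -
  have "\<mu> < 1 / x" using assms by (simp add: field_simps)
  then obtain \<rho> where rho: "\<mu> < \<rho>" "\<rho> < 1 / x" using dense by blast
  have rx: "0 \<le> x * \<rho>" "x * \<rho> < 1" using assms rho by (auto simp: field_simps)
  obtain n0 where n0: "\<And>n. n0 \<le> n \<Longrightarrow> root n (real (saw_num N n v {})) < \<rho>"
    using order_tendstoD(2)[OF lim rho(1)] unfolding eventually_sequentially by blast
  have "summable (\<lambda>n. real (saw_num N n v {}) * x ^ n)"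
  proof (rule summable_comparison_test')
    show "summable (\<lambda>n. (x * \<rho>) ^ n)" using rx by (intro summable_geometric) simp
    fix n assume n: "max n0 1 \<le> n"
    then have "root n (real (saw_num N n v {})) ^ n \<le> \<rho> ^ n"
      using n0[of n] by (intro power_mono) auto
    then have "real (saw_num N n v {}) \<le> \<rho> ^ n" using n by simp
    then have "real (saw_num N n v {}) * x ^ n \<le> \<rho> ^ n * x ^ n"
      using assms(3) by (intro mult_right_mono) auto
    then show "norm (real (saw_num N n v {}) * x ^ n) \<le> (x * \<rho>) ^ n"
      using assms(3) by (simp add: power_mult_distrib mult.commute)
  qed
  then have "saw_gf N x M v {} \<le> (\<Sum>n. real (saw_num N n v {}) * x ^ n)" for M
    unfolding saw_gf_def using assms(3) by (intro sum_le_suminf) auto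
  then show ?thesis by blast
qed

text \<open>If \<open>x * \<mu>\<close> exceeded 1, a single term of the partial sum would
  eventually exceed \<open>C\<close>.\<close>

lemma saw_gf_bounded_imp_le:
  assumes lim: "(\<lambda>n. root n (real (saw_num N n v {}))) \<longlonglongrightarrow> \<mu>"
    and "0 < \<mu>" and x: "0 < x" and bound: "\<And>M. saw_gf N x M v {} \<le> C"
  shows "x * \<mu> \<le> 1"
proof (rule ccontr)
  assume "\<not> x * \<mu> \<le> 1"
  then have "1 / x < \<mu>" using x by (simp add: field_simps)
  then obtain r where r: "1 / x < r" "r < \<mu>" using dense by blast
  have r0: "0 < r" using r(1) x by (smt (verit) divide_pos_pos)
  have rx: "1 < r * x" using r x by (simp add: field_simps)
  obtain n0 where n0: "\<And>n. n0 \<le> n \<Longrightarrow> r < root n (real (saw_num N n v {}))"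
    using order_tendstoD(1)[OF lim r(2)] unfolding eventually_sequentially by blast
  obtain k where k: "C < (r * x) ^ k" using real_arch_pow[OF rx] by blast
  define n where "n = max k (max n0 1)"
  have "(r * x) ^ k \<le> (r * x) ^ n" using rx by (intro power_increasing) (auto simp: n_def)
  also have "\<dots> \<le> real (saw_num N n v {}) * x ^ n"
  proof -
    have "r ^ n \<le> root n (real (saw_num N n v {})) ^ n"
    proof (rule power_mono)
      have "n0 \<le> n" by (simp add: n_def)
      then show "r \<le> root n (real (saw_num N n v {}))" using n0 by (simp add: less_imp_le)
    qed (use r0 in simp)
    also have "\<dots> = real (saw_num N n v {})" by (simp add: n_def)
    finally show ?thesis using x by (simp add: power_mult_distrib)
  qed
  also have "\<dots> \<le> saw_gf N x n v {}"
    unfolding saw_gf_def using x by (intro member_le_sum) auto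
  finally show False using k bound[of n] by linarith
qed

text \<open>The first step from \<open>t\<close> lands in \<open>S\<close>, where walks avoiding
  \<open>t\<close> are bounded; this bounds the walks from \<open>t\<close>, and cutting at
  \<open>t\<close> then bounds all others.\<close>

lemma saw_gf_bounded_remove:
  assumes x: "0 \<le> x" and fin: "\<And>u. finite (N u)" and "N t \<subseteq> S"
    and bound: "\<And>M s. s \<in> S \<Longrightarrow> saw_gf N x M s (insert t B) \<le> C"
  shows "\<exists>C'. \<forall>M. \<forall>s\<in>S. saw_gf N x M s B \<le> C'"
proof -
  define D where "D = 1 + x * (real (card (N t)) * \<bar>C\<bar>)"
  have bound': "saw_gf N x M s (insert t B) \<le> \<bar>C\<bar>" if "s \<in> S" for M s
    using bound[OF that, of M] by linarith
  have D: "saw_gf N x M t B \<le> D" for M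
  proof -
    have "saw_gf N x M t B \<le> 1 + x * (\<Sum>u\<in>N t. saw_gf N x M u (insert t B))"
      by (rule saw_gf_le_step[OF x])
    also have "\<dots> \<le> 1 + x * (\<Sum>u\<in>N t. \<bar>C\<bar>)"
      using x assms(3) bound' by (intro add_left_mono mult_left_mono sum_mono) auto
    finally show ?thesis by (simp add: D_def)
  qed
  have D0: "0 \<le> D" using x by (simp add: D_def)
  have "saw_gf N x M s B \<le> D + \<bar>C\<bar> * (1 + x * D)" if s: "s \<in> S" for M s
  proof (cases "s = t")
    case True
    have "0 \<le> \<bar>C\<bar> * (1 + x * D)" using x D0 by simp
    then show ?thesis using D[of M] True by simp
  next
    case False
    have "saw_gf N x M s B \<le> saw_gf N x M s (insert t B) * (1 + x * saw_gf N x M t B)"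
      by (rule saw_gf_split[OF x fin False])
    also have "\<dots> \<le> \<bar>C\<bar> * (1 + x * D)"
      using x D0 D bound'[OF s]
      by (intro mult_mono add_left_mono mult_left_mono add_nonneg_nonneg mult_nonneg_nonneg
          saw_gf_nonneg) auto
    finally show ?thesis using D0 by linarith
  qed
  then show ?thesis by blast
qed

context cubic_fvert_graph begin

text \<open>The start triangle is the only one that a walk can leave more than once; forbidding its
  corners one after the other reduces to walks that never return to it.\<close>

lemma fisher_gf_bounded:
  assumes x: "0 \<le> x" and vV: "v \<in> verts H"
    and bound: "\<And>u. u \<in> N v \<Longrightarrow> \<exists>C. \<forall>M. saw_gf N (x ^ 2 + x ^ 3) M u {} \<le> C"
  shows "\<exists>s\<in>verts (fisher H). \<exists>C. \<forall>M. saw_gf N' x M s {} \<le> C"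
proof -
  define K where "K = 1 + 2 * x + 2 * x ^ 2 + 2 * (x ^ 2 + x ^ 3)"
  have K0: "0 \<le> K" using x by (simp add: K_def)
  define T where "T = Corner v ` N v"
  \<comment> \<open>The corners of the start triangle with their partners across the edges, so that
    every first step from \<open>T\<close> stays in \<open>S\<close>.\<close>
  define S where "S = T \<union> (\<lambda>u. Corner u v) ` N v"
  have N'_T: "N' t \<subseteq> S" if "t \<in> T" for t
    using that by (auto simp: T_def S_def N'_Corner)
  obtain C where C: "\<And>u M. u \<in> N v \<Longrightarrow> saw_gf N (x ^ 2 + x ^ 3) M u {} \<le> C u"
    using bound by metis
  have base: "saw_gf N' x M s T \<le> (\<Sum>u\<in>N v. K * \<bar>C u\<bar>)" if s: "s \<in> S" for M s
  proof (cases "s \<in> T")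
    case True
    then show ?thesis using K0 by (simp add: sum_nonneg)
  next
    case False
    then obtain u where u: "u \<in> N v" "s = Corner u v" using s by (auto simp: S_def)
    have "saw_gf N' x M s T \<le> K * saw_gf N (x ^ 2 + x ^ 3) M u {v}"
      unfolding u(2) K_def using u irrefl sym x
      by (intro fisher_gf_upper) (auto simp: T_def)
    also have "\<dots> \<le> K * \<bar>C u\<bar>"
    proof (rule mult_left_mono[OF _ K0])
      have "saw_gf N (x ^ 2 + x ^ 3) M u {v} \<le> saw_gf N (x ^ 2 + x ^ 3) M u {}"
        using x by (intro saw_gf_antimono) auto
      then show "saw_gf N (x ^ 2 + x ^ 3) M u {v} \<le> \<bar>C u\<bar>" using C[OF u(1), of M] by linarith
    qed
    also have "\<dots> \<le> (\<Sum>u\<in>N v. K * \<bar>C u\<bar>)"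
      using u K0 finite_N by (intro member_le_sum) auto
    finally show ?thesis .
  qed
  \<comment> \<open>\<open>R\<close> collects the corners already released and grows from the empty
    set to \<open>T\<close>.\<close>
  have "\<exists>C. \<forall>M. \<forall>s\<in>S. saw_gf N' x M s (T - R) \<le> C" if "R \<subseteq> T" for R
  proof -
    have "finite R" using finite_subset[OF that] finite_N by (simp add: T_def)
    then show ?thesis using that
    proof (induction R rule: finite_induct)
      case empty
      then show ?case using base by auto
    next
      case (insert t R)
      then obtain C' where C': "\<And>M s. s \<in> S \<Longrightarrow> saw_gf N' x M s (T - R) \<le> C'" by auto
      have "T - R = insert t (T - insert t R)" using insert by auto
      then show ?case
        using saw_gf_bounded_remove[of x N' t S "T - insert t R" C'] x insert.prems N'_T C'
          cubic_system.finite_N[OF cubic_system_fisher] by auto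
    qed
  qed
  from this[OF subset_refl] obtain C' where C': "\<And>M s. s \<in> S \<Longrightarrow> saw_gf N' x M s {} \<le> C'" by auto
  have "N v \<noteq> {}" using card_N[OF vV] by fastforce
  then obtain u where "u \<in> N v" by blast
  then have "Corner v u \<in> S" "Corner v u \<in> verts (fisher H)"
    by (auto simp: S_def T_def verts_fisher)
  then show ?thesis using C' by blast
qed

text \<open>Put \<open>y = inverse \<mu>'\<close>. For \<open>x < y\<close> the series of
  \<open>fisher H\<close> is bounded, hence also that of \<open>H\<close> at \<open>g x\<close>, and
  letting \<open>x\<close> tend to \<open>y\<close> gives \<open>g y * \<mu> \<le> 1\<close>. Were
  this strict, continuity would give some \<open>x > y\<close> with \<open>g x * \<mu> < 1\<close>,
  at which the series of \<open>fisher H\<close> is bounded, a contradiction.\<close>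

theorem fisher_growth:
  assumes lim: "\<And>v. v \<in> verts H \<Longrightarrow> (\<lambda>n. root n (real (saw_num N n v {}))) \<longlonglongrightarrow> \<mu>"
    and lim': "\<And>s. s \<in> verts (fisher H) \<Longrightarrow> (\<lambda>n. root n (real (saw_num N' n s {}))) \<longlonglongrightarrow> \<mu>'"
    and pos: "0 < \<mu>" "0 < \<mu>'"
  shows "inverse \<mu> = (inverse \<mu>') ^ 2 + (inverse \<mu>') ^ 3"
proof -
  define g :: "real \<Rightarrow> real" where "g x = x ^ 2 + x ^ 3" for x
  define y where "y = inverse \<mu>'"
  have y0: "0 < y" using pos by (simp add: y_def)
  have g_pos: "0 < g x" if "0 < x" for x using that by (simp add: g_def add_pos_pos)
  obtain v where v: "v \<in> verts H" using infinite_V by fastforce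
  have below: "g x * \<mu> \<le> 1" if x: "0 < x" "x < y" for x
  proof -
    have xmu: "x * \<mu>' < 1" using x pos by (simp add: y_def field_simps)
    have "\<exists>C. \<forall>M. saw_gf N (g x) M u {v} \<le> C" if u: "u \<in> N v" for u
    proof -
      have vu: "Corner v u \<in> verts (fisher H)" using u by (simp add: verts_fisher)
      obtain C where C: "\<And>M. saw_gf N' x M (Corner v u) {} \<le> C"
        using saw_gf_bounded_if_subcritical[OF lim'[OF vu]] pos x xmu by fastforce
      have "saw_gf N (g x) M u {v} \<le> C / x" for M
      proof -
        \<comment> \<open>The lifted walks start at \<open>Corner u v\<close> and avoid
          \<open>Corner v u\<close>; prefixing the crossing makes them walks from
          \<open>Corner v u\<close>, at the price of the factor \<open>x\<close>.\<close>
        have "saw_gf N (g x) M u {v} \<le> saw_gf N' x (3 * M) (Corner u v) {Corner v u}"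
          unfolding g_def using x u sym by (intro fisher_gf_lower) auto
        also have "x * \<dots> \<le> x * (\<Sum>s\<in>N' (Corner v u). saw_gf N' x (3 * M) s {Corner v u})"
        proof (rule mult_left_mono[OF member_le_sum])
          show "Corner u v \<in> N' (Corner v u)" using u by (simp add: N'_Corner)
          show "finite (N' (Corner v u))" by (rule cubic_system.finite_N[OF cubic_system_fisher])
        qed (use x in \<open>simp_all add: saw_gf_nonneg\<close>)
        also have "\<dots> \<le> saw_gf N' x (Suc (3 * M)) (Corner v u) {}" by (simp add: saw_gf_Suc)
        also have "\<dots> \<le> C" by (rule C)
        finally show ?thesis using x by (simp add: field_simps)
      qed
      then show ?thesis by blast
    qed
    then obtain C where C: "\<And>u M. u \<in> N v \<Longrightarrow> saw_gf N (g x) M u {v} \<le> C u" by metis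
    have gx: "0 < g x" using g_pos x by blast
    have "saw_gf N (g x) M v {} \<le> 1 + g x * (\<Sum>u\<in>N v. C u)" for M
    proof -
      have "saw_gf N (g x) M v {} \<le> 1 + g x * (\<Sum>u\<in>N v. saw_gf N (g x) M u {v})"
        using gx by (intro saw_gf_le_step) auto
      also have "\<dots> \<le> 1 + g x * (\<Sum>u\<in>N v. C u)"
        using gx C by (intro add_left_mono mult_left_mono sum_mono) auto
      finally show ?thesis .
    qed
    then show ?thesis using saw_gf_bounded_imp_le[OF lim[OF v] pos(1) gx] by blast
  qed
  have above: "x * \<mu>' \<le> 1" if x: "0 < x" "g x * \<mu> < 1" for x
  proof -
    have "\<exists>C. \<forall>M. saw_gf N (x ^ 2 + x ^ 3) M u {} \<le> C" if "u \<in> N v" for u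
      using saw_gf_bounded_if_subcritical[OF lim, of u "g x"] simple_graph_nbrs[OF simple that]
        pos g_pos[OF x(1)] x(2) unfolding g_def by simp
    then obtain s C where "s \<in> verts (fisher H)" "\<And>M. saw_gf N' x M s {} \<le> C"
      using fisher_gf_bounded[of x v] x v by auto
    then show ?thesis using saw_gf_bounded_imp_le[OF lim'] pos x by blast
  qed
  have cont: "(\<lambda>x. g x * \<mu>) \<midarrow>y\<rightarrow> g y * \<mu>"
    unfolding g_def by (intro tendsto_intros)
  have "g y * \<mu> \<le> 1"
  proof (rule tendsto_upperbound)
    show "((\<lambda>x. g x * \<mu>) \<longlongrightarrow> g y * \<mu>) (at_left y)"
      using cont by (rule tendsto_within_subset) simp
    show "eventually (\<lambda>x. g x * \<mu> \<le> 1) (at_left y)"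
      using eventually_at_left_real[OF y0] by eventually_elim (use below in auto)
  qed simp
  moreover have "\<not> g y * \<mu> < 1"
  proof
    assume "g y * \<mu> < 1"
    then have "eventually (\<lambda>x. g x * \<mu> < 1) (at_right y)"
      using order_tendstoD(2)[OF tendsto_within_subset[OF cont subset_UNIV]] by blast
    moreover have "eventually (\<lambda>x. y < x) (at_right y)" by (simp add: eventually_at_right_less)
    ultimately have "eventually (\<lambda>x. y < x \<and> g x * \<mu> < 1) (at_right y)" by eventually_elim simp
    then obtain x where x: "y < x" "g x * \<mu> < 1" using eventually_happens'[of "at_right y"] by auto
    then have "x * \<mu>' \<le> 1" using above y0 by auto
    then show False using x pos by (simp add: y_def field_simps)
  qed
  ultimately have "\<mu> * g y = 1" by (simp add: mult.commute)
  then have "inverse \<mu> = g y" by (rule inverse_unique)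
  then show ?thesis by (simp add: g_def y_def)
qed

text \<open>Makes the results of the locale available at every stage of the iteration.\<close>

lemma cubic_fvert_graph_fisher: "cubic_fvert_graph (fisher H)"
  by unfold_locales (use simple_graph_fisher[OF simple] cubic_system_fisher in \<open>auto simp: cubic_system_def\<close>)

text \<open>The limit exists at all vertices, and uniqueness of limits at one vertex shows that the
  definite description denotes it.\<close>

lemma connective_constant_limit:
  "1 \<le> connective_constant H \<and> connective_constant H \<le> 2 \<and>
    (\<forall>v\<in>verts H. (\<lambda>n. root n (real (saw_num N n v {}))) \<longlonglongrightarrow> connective_constant H)"
proof -
  obtain \<mu> where mu: "1 \<le> \<mu>" "\<mu> \<le> 2"
    "\<And>v. v \<in> verts H \<Longrightarrow> (\<lambda>n. root n (real (saw_num N n v {}))) \<longlonglongrightarrow> \<mu>"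
    using saw_num_growth by blast
  obtain v where v: "v \<in> verts H" using infinite_V by fastforce
  have count: "saw_count H v n = saw_num N n v {}" if "v \<in> verts H" for v n
    using saw_count_eq_saw_num[OF simple finite_N that] .
  have "connective_constant H = \<mu>"
    unfolding connective_constant_def
  proof (rule the_equality)
    show "\<forall>v\<in>verts H. (\<lambda>n. root n (real (saw_count H v n))) \<longlonglongrightarrow> \<mu>" using mu(3) count by simp
    show "\<mu>' = \<mu>" if "\<forall>v\<in>verts H. (\<lambda>n. root n (real (saw_count H v n))) \<longlonglongrightarrow> \<mu>'" for \<mu>'
      using that mu(3)[OF v] v count[OF v] LIMSEQ_unique by fastforce
  qed
  then show ?thesis using mu by blast
qed

lemma inverse_connective_constant_fisher:
  "inverse (connective_constant H) = (inverse (connective_constant (fisher H))) ^ 2 +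
    (inverse (connective_constant (fisher H))) ^ 3"
proof -
  have "1 \<le> connective_constant (fisher H) \<and> (\<forall>v\<in>verts (fisher H).
      (\<lambda>n. root n (real (saw_num N' n v {}))) \<longlonglongrightarrow> connective_constant (fisher H))"
    using cubic_fvert_graph.connective_constant_limit[OF cubic_fvert_graph_fisher] by blast
  then show ?thesis using connective_constant_limit by (intro fisher_growth) auto
qed

end

section \<open>Backward iteration of the cubic\<close>

text \<open>The difference quotient is \<open>x + p + x * x + x * p + p * p\<close>: two terms of at
  least \<open>1 / 2\<close> and three of at least \<open>1 / 4\<close> add up to at least
  \<open>7 / 4\<close>.\<close>

lemma cubic_expansion:
  fixes x p :: real
  assumes "1 / 2 \<le> x" and "1 / 2 \<le> p"
  shows "7 / 4 * \<bar>x - p\<bar> \<le> \<bar>(x ^ 2 + x ^ 3) - (p ^ 2 + p ^ 3)\<bar>"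
proof -
  have sq: "1 / 2 * (1 / 2) \<le> a * b" if "1 / 2 \<le> a" "1 / 2 \<le> b" for a b :: real
    using that by (intro mult_mono) auto
  define q where "q = x + p + x * x + x * p + p * p"
  have "7 / 4 \<le> q"
    unfolding q_def using assms sq[OF assms(1,1)] sq[OF assms] sq[OF assms(2,2)] by linarith
  then have "7 / 4 * \<bar>x - p\<bar> \<le> \<bar>q\<bar> * \<bar>x - p\<bar>" by (intro mult_right_mono) auto
  moreover have "(x ^ 2 + x ^ 3) - (p ^ 2 + p ^ 3) = q * (x - p)"
    by (simp add: q_def algebra_simps power2_eq_square power3_eq_cube)
  ultimately show ?thesis by (simp only: abs_mult)
qed

text \<open>The quadratic equation makes the inverse a fixed point of the cubic:
  \<open>t ^ 2 + t ^ 3 = t * (t + t ^ 2) = t\<close>.\<close>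

lemma inverse_golden_mean:
  "inverse golden_mean = (sqrt 5 - 1) / 2"
  "(inverse golden_mean) ^ 2 = 1 - inverse golden_mean"
  "1 / 2 \<le> inverse golden_mean" "inverse golden_mean \<le> 1"
proof -
  have "golden_mean * ((sqrt 5 - 1) / 2) = 1" by (simp add: golden_mean_def algebra_simps)
  then show eq: "inverse golden_mean = (sqrt 5 - 1) / 2" by (rule inverse_unique)
  show "(inverse golden_mean) ^ 2 = 1 - inverse golden_mean"
    unfolding eq by (simp add: power2_eq_square field_simps)
  have "2 \<le> sqrt 5" by (rule real_le_rsqrt) simp
  moreover have "sqrt 5 \<le> 3" by (rule real_le_lsqrt) simp_all
  ultimately show "1 / 2 \<le> inverse golden_mean" "inverse golden_mean \<le> 1" unfolding eq by simp_all
qed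

text \<open>The cubic is increasing with fixed point \<open>p\<close>, so all \<open>y k\<close> lie
  on one side of \<open>p\<close>, where \<open>y k - y (Suc k)\<close> has constant sign. Read
  backwards, the expansion by \<open>7 / 4\<close> is a contraction by \<open>4 / 7\<close>.\<close>

lemma backward_cubic_iteration:
  fixes y :: "nat \<Rightarrow> real"
  assumes rec: "\<And>k. y k = (y (Suc k)) ^ 2 + (y (Suc k)) ^ 3"
    and range: "\<And>k. 1 / 2 \<le> y k \<and> y k \<le> 1"
  shows "monoseq y" and "\<bar>y k - inverse golden_mean\<bar> \<le> (4 / 7) ^ k"
proof -
  define p where "p = inverse golden_mean"
  have p2: "p ^ 2 = 1 - p" and p_range: "1 / 2 \<le> p" "p \<le> 1"
    using inverse_golden_mean(2-4) by (simp_all add: p_def)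
  have "p ^ 2 + p ^ 3 = p * (p + p ^ 2)" by (simp add: power3_eq_cube power2_eq_square algebra_simps)
  then have p: "p ^ 2 + p ^ 3 = p" "1 / 2 \<le> p" "p \<le> 1" using p_range by (simp_all add: p2)
  have diff: "y k - p = (y (Suc k) + p + y (Suc k) * y (Suc k) + y (Suc k) * p + p * p) * (y (Suc k) - p)"
    for k
    using p(1) rec[of k] by (simp add: algebra_simps power2_eq_square power3_eq_cube)
  \<comment> \<open>The difference is \<open>t * (t ^ 2 + t - 1)\<close> at
    \<open>t = y (Suc k)\<close>; the quadratic has the roots \<open>p\<close> and
    \<open>- 1 - p\<close>.\<close>
  have drop: "y k - y (Suc k) = y (Suc k) * (y (Suc k) + p + 1) * (y (Suc k) - p)" for k
  proof -
    have "(y (Suc k) + p + 1) * (y (Suc k) - p) = y (Suc k) ^ 2 + y (Suc k) - (p ^ 2 + p)"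
      by (simp add: algebra_simps power2_eq_square)
    also have "\<dots> = y (Suc k) ^ 2 + y (Suc k) - 1" by (simp add: p2)
    finally have "y (Suc k) * (y (Suc k) + p + 1) * (y (Suc k) - p) =
        y (Suc k) * (y (Suc k) ^ 2 + y (Suc k) - 1)" by (simp only: mult.assoc)
    also have "\<dots> = y k - y (Suc k)"
      using rec[of k] by (simp add: algebra_simps power2_eq_square power3_eq_cube)
    finally show ?thesis by (rule sym)
  qed
  have factor_pos: "0 < y (Suc k) + p + y (Suc k) * y (Suc k) + y (Suc k) * p + p * p"
    "0 < y (Suc k) * (y (Suc k) + p + 1)" for k
    using range[of "Suc k"] p by (auto intro!: add_pos_pos mult_pos_pos)
  have side: "(y (Suc k) \<le> p \<longleftrightarrow> y k \<le> p)" for k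
  proof -
    have "y (Suc k) - p \<le> 0 \<longleftrightarrow> y k - p \<le> 0"
      unfolding diff[of k] using factor_pos(1)[of k] by (simp add: mult_le_0_iff)
    then show ?thesis by simp
  qed
  then have side0: "y k \<le> p \<longleftrightarrow> y 0 \<le> p" for k by (induction k) auto
  show "monoseq y"
  proof (cases "y 0 \<le> p")
    case True
    have "y k - y (Suc k) \<le> 0" for k
      unfolding drop[of k]
      by (rule mult_nonneg_nonpos) (use True side0[of "Suc k"] factor_pos(2)[of k] in auto)
    then show ?thesis by (simp add: monoseq_Suc)
  next
    case False
    have "0 \<le> y k - y (Suc k)" for k
      unfolding drop[of k]
      by (rule mult_nonneg_nonneg) (use False side0[of "Suc k"] factor_pos(2)[of k] in auto)
    then show ?thesis by (simp add: monoseq_Suc)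
  qed
  show "\<bar>y k - inverse golden_mean\<bar> \<le> (4 / 7) ^ k"
    unfolding p_def[symmetric]
  proof (induction k)
    case 0
    then show ?case using range[of 0] p by (simp add: abs_if)
  next
    case (Suc k)
    have "7 / 4 * \<bar>y (Suc k) - p\<bar> \<le> \<bar>y k - p\<bar>"
      using cubic_expansion[of "y (Suc k)" p] range[of "Suc k"] p rec[of k] by simp
    then show ?case using Suc by simp
  qed
qed

section \<open>The sequence of iterated Fisher graphs\<close>

lemma cubic_fvert_graph_fisher_seq:
  assumes "simple_graph G" and "infinite_graph G" and "connected_graph G"
    and "cubic_graph G" and "quasi_transitive G"
  shows "cubic_fvert_graph (fisher_seq G k)"
proof (induction k)
  case 0
  have inj: "inj (Orig :: 'a \<Rightarrow> 'a fvert)" by (simp add: inj_def)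
  show ?case
    using simple_graph_relabel[OF inj assms(1)]
      cubic_system_relabel[OF inj assms(1) cubic_system_nbrs[OF assms]]
    by (simp add: cubic_fvert_graph_def)
next
  case (Suc k)
  then show ?case using cubic_fvert_graph.cubic_fvert_graph_fisher by simp
qed

theorem theorem3p1:
  fixes G :: "'a ugraph" and \<mu> :: "nat \<Rightarrow> real" and g :: "real \<Rightarrow> real"
  assumes "simple_graph G"
    and "infinite_graph G"
    and "connected_graph G"
    and "cubic_graph G"
    and "quasi_transitive G"
    and \<mu>: "\<And>k. \<mu> k = connective_constant (fisher_seq G k)"
    and g: "\<And>x. g x = x ^ 2 + x ^ 3"
  shows "(\<forall>k. inverse (\<mu> k) = g (inverse (\<mu> (Suc k)))) \<and>
    (monoseq \<mu> \<and> \<mu> \<longlonglongrightarrow> golden_mean) \<and>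
    (\<forall>k\<ge>1. - ((4 / 7) ^ k) \<le> inverse (\<mu> k) - inverse golden_mean \<and>
            inverse (\<mu> k) - inverse golden_mean \<le> ((7 - sqrt 5) / 2) ^ k)"
proof -
  note graph = cubic_fvert_graph_fisher_seq[OF assms(1-5)]
  define y where "y k = inverse (\<mu> k)" for k
  have mu: "1 \<le> \<mu> k" "\<mu> k \<le> 2" for k
    using cubic_fvert_graph.connective_constant_limit[OF graph, of k] by (auto simp: \<mu>)
  have rec: "y k = (y (Suc k)) ^ 2 + (y (Suc k)) ^ 3" for k
    using cubic_fvert_graph.inverse_connective_constant_fisher[OF graph, of k] by (simp add: y_def \<mu>)
  have range: "1 / 2 \<le> y k \<and> y k \<le> 1" for k
    using mu[of k] by (simp add: y_def field_simps)
  note iter = backward_cubic_iteration[of y, OF rec range]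
  have "monoseq \<mu>"
  proof -
    \<comment> \<open>Inversion reverses the order, and \<open>monoseq\<close> admits either
      direction.\<close>
    have "\<mu> m \<le> \<mu> n \<longleftrightarrow> y n \<le> y m" for m n
      using mu(1)[of m] mu(1)[of n] inverse_le_iff_le[of "\<mu> n" "\<mu> m"] by (simp add: y_def)
    then show ?thesis using iter(1) unfolding monoseq_def by auto
  qed
  moreover have "\<mu> \<longlonglongrightarrow> golden_mean"
  proof -
    have "(\<lambda>k. y k - inverse golden_mean) \<longlonglongrightarrow> 0"
      by (rule tendsto_0_le[where K = 1, OF LIMSEQ_power_zero[of "4 / 7 :: real"]])
        (use iter(2) in auto)
    then have "y \<longlonglongrightarrow> inverse golden_mean" by (simp add: LIM_zero_iff)
    then have "(\<lambda>k. inverse (y k)) \<longlonglongrightarrow> inverse (inverse golden_mean)"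
      using inverse_golden_mean(3) by (intro tendsto_inverse) auto
    then show ?thesis by (simp add: y_def)
  qed
  moreover have "- ((4 / 7) ^ k) \<le> y k - inverse golden_mean" for k
    using iter(2)[of k] by linarith
  moreover have "y k - inverse golden_mean \<le> ((7 - sqrt 5) / 2) ^ k" for k
  proof -
    \<comment> \<open>The base \<open>(7 - sqrt 5) / 2\<close> is at least 2, so its powers are at
      least 1, while two numbers in \<open>[1/2, 1]\<close> differ by at most
      \<open>1 / 2\<close>.\<close>
    have "sqrt 5 \<le> 3" by (rule real_le_lsqrt) simp_all
    then have "1 \<le> ((7 - sqrt 5) / 2) ^ k" by (intro one_le_power) simp
    then show ?thesis using range[of k] inverse_golden_mean(3) by linarith
  qed
  moreover have "inverse (\<mu> k) = g (inverse (\<mu> (Suc k)))" for k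
    using rec[of k] by (simp only: y_def g)
  ultimately show ?thesis unfolding y_def by blast
qed

end
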